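(* Let $\vartheta_1,\vartheta_2\in\mathbb C^\times$, $\gamma,\chi\in\mathbb C$, $\epsilon\in\{\pm1\}$ with $\vartheta_2=\vartheta_1(2\gamma+\varpi_1)$ and $\vartheta_1\chi=\epsilon$. Let $M$ be an irreducible $\mathscr H^l_{\vartheta_1,\vartheta_2}$-module. Then $\mathcal D^\epsilon_{\mathbf s,\boldsymbol\varepsilon}(M)$ is either $0$ or an irreducible $\mathscr B_{\mathbf s,\boldsymbol\varepsilon}$-module.
   Context: Fix integers $m,n\ge0$, $\kappa=m+n$, a parity sequence $\mathbf s\in\{\pm1\}^\kappa$ with exactly $m$ entries $1$, $s_i=(-1)^{|i|}$, $\boldsymbol\varepsilon\in\{\pm1\}^\kappa$, $G=\mathrm{diag}(\varepsilon_1,\dots,\varepsilon_\kappa)$, $\varpi_1=\sum_as_a\varepsilon_a$, $\jmath=(m-n)/2$. $V=\mathbb C^{m|n}$ with basis $v_i$ of parity $|i|$, matrix units $E_{ij}$, $R(u)=1-\frac1u\sum_{i,j}s_jE_{ij}\otimes E_{ji}$. The twisted super Yangian $\mathscr B_{\mathbf s,\boldsymbol\varepsilon}$ is generated by $b_{ij}^{(r)}$ of parity $|i|+|j|$ with $b_{ij}(u)=\delta_{ij}\varepsilon_i+\sum_rb_{ij}^{(r)}u^{-r}$, $B(u)=\sum(-1)^{|i||j|+|j|}b_{ij}(u)\otimes E_{ij}$, relations $R(u-v)B_1(u)R(u+v)B_2(v)=B_2(v)R(u+v)B_1(u)R(u-v)$, $B(u)B(-u)=1$. Degenerate affine Hecke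 algebra: $\mathscr W_l=\mathbb Z_2\wr\mathfrak S_l$ with transpositions $\sigma_{ij}$, $\sigma_i=\sigma_{i,i+1}$, sign changes $\varsigma_i$; $\mathscr H^l_{\vartheta_1,\vartheta_2}$ is generated by $\mathbb C[\mathscr W_l]$ and commuting $y_1,\dots,y_l$ with $\sigma_iy_i-y_{i+1}\sigma_i=\vartheta_1$, $\varsigma_ly_i=y_i\varsigma_l$ ($i<l$), $\varsigma_ly_l+y_l\varsigma_l=\vartheta_2$, $\sigma_iy_j=y_j\sigma_i$ ($j\ne i,i+1$). Drinfeld functor: $\mathscr W_l$ acts diagonally on $M\otimes V^{\otimes l}$, with $\sigma_{ij}$ acting on $V^{\otimes l}$ by $\sum_{a,b}s_bE^{(i)}_{ab}E^{(j)}_{ba}$ ($E^{(k)}$ = action on $k$-th factor) and $\varsigma_k$ by $G$ on the $k$-th factor; $\mathcal D^\epsilon_{\mathbf s,\boldsymbol\varepsilon}(M)=(M\otimes V^{\otimes l})/(\sum_{i<l}\mathrm{Im}(\sigma_i-\epsilon)+\mathrm{Im}(\varsigma_l-\epsilon))$, with $\mathscr B_{\mathbf s,\boldsymbol\varepsilon}$ acting via $B(u)\mapsto\mathcal T_1(u)\cdots\mathcal T_l(u)(G+\gamma u^{-1})\mathcal S_l(-u)\cdots\mathcal S_1(-u)$, where $\mathcal Q^{(k)}=\sum_{i,j}(-1)^{|i||j|+|i|+|j|}E^{(k)}_{ij}\otimes E_{ij}$, $\mathcal T_k(u)=1+\frac{1}{u-\jmath-\chi y_k}\otimes\mathcal Q^{(k)}$,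 $\mathcal S_k(u)=1-\frac{1}{u+\jmath-\chi y_k}\otimes\mathcal Q^{(k)}$. *)

theory Defs
  imports Complex_Main "HOL-Library.Function_Algebras"
begin

text \<open>
Conventions.  The basis of V = C^{m|n} is indexed by 1..kappa (kappa = m+n).  An element of
M (x) V^{(x) l} is represented by its coefficient function  f :: nat list => 'm, where the
list a = [a_1,...,a_l] (entries in 1..kappa) stands for the basis tensor v_{a_1} (x) ... (x) v_{a_l};
i.e. f corresponds to sum_a f(a) (x) v_a, and f vanishes outside the admissible index lists.
The H-module M is the whole type 'm, a complex vector space with scalar multiplication sc.
\<close>

definition is_subspace :: "('c \<Rightarrow> 'v::ab_group_add \<Rightarrow> 'v) \<Rightarrow> 'v set \<Rightarrow> bool" where
  "is_subspace sc S \<longleftrightarrow> 0 \<in> S \<and> (\<forall>x\<in>S. \<forall>y\<in>S. x + y \<in> S) \<and> (\<forall>c. \<forall>x\<in>S. sc c x \<in> S)"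

definition is_linear :: "('c \<Rightarrow> 'v::ab_group_add \<Rightarrow> 'v) \<Rightarrow> ('v \<Rightarrow> 'v) \<Rightarrow> bool" where
  "is_linear sc f \<longleftrightarrow> (\<forall>x y. f (x + y) = f x + f y) \<and> (\<forall>c x. f (sc c x) = sc c (f x))"

text \<open>Modules over the degenerate affine Hecke algebra H^l_{th1,th2}: a complex vector space with
 linear operators sigma_i (1 <= i <= l-1), varsigma = varsigma_l, y_k (1 <= k <= l) satisfying the
 Coxeter relations of the type B_l Weyl group W_l = Z_2 wr S_l (generated by the sigma_i and
 varsigma_l) and the defining relations of H^l.\<close>

definition is_Hmod ::
  "(complex \<Rightarrow> 'm::ab_group_add \<Rightarrow> 'm) \<Rightarrow> nat \<Rightarrow> complex \<Rightarrow> complex \<Rightarrow>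
   (nat \<Rightarrow> 'm \<Rightarrow> 'm) \<Rightarrow> ('m \<Rightarrow> 'm) \<Rightarrow> (nat \<Rightarrow> 'm \<Rightarrow> 'm) \<Rightarrow> bool" where
  "is_Hmod sc l th1 th2 \<sigma> \<zeta> y \<longleftrightarrow>
     vector_space sc \<and>
     (\<forall>i\<in>{1..<l}. is_linear sc (\<sigma> i)) \<and> is_linear sc \<zeta> \<and> (\<forall>k\<in>{1..l}. is_linear sc (y k)) \<and>
     \<comment> \<open>Coxeter relations of W_l\<close>
     (\<forall>i\<in>{1..<l}. \<sigma> i \<circ> \<sigma> i = id) \<and>
     (\<forall>i. 1 \<le> i \<and> i + 1 < l \<longrightarrow> \<sigma> i \<circ> \<sigma> (i+1) \<circ> \<sigma> i = \<sigma> (i+1) \<circ> \<sigma> i \<circ> \<sigma> (i+1)) \<and>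
     (\<forall>i\<in>{1..<l}. \<forall>j\<in>{1..<l}. i + 1 < j \<longrightarrow> \<sigma> i \<circ> \<sigma> j = \<sigma> j \<circ> \<sigma> i) \<and>
     \<zeta> \<circ> \<zeta> = id \<and>
     (\<forall>i. 1 \<le> i \<and> i + 1 < l \<longrightarrow> \<sigma> i \<circ> \<zeta> = \<zeta> \<circ> \<sigma> i) \<and>
     (2 \<le> l \<longrightarrow> \<sigma> (l-1) \<circ> \<zeta> \<circ> \<sigma> (l-1) \<circ> \<zeta> = \<zeta> \<circ> \<sigma> (l-1) \<circ> \<zeta> \<circ> \<sigma> (l-1)) \<and>
     \<comment> \<open>relations involving the y's\<close>
     (\<forall>i\<in>{1..l}. \<forall>j\<in>{1..l}. y i \<circ> y j = y j \<circ> y i) \<and>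
     (\<forall>i\<in>{1..<l}. \<forall>x. \<sigma> i (y i x) - y (i+1) (\<sigma> i x) = sc th1 x) \<and>
     (\<forall>i\<in>{1..<l}. \<zeta> \<circ> y i = y i \<circ> \<zeta>) \<and>
     (\<forall>x. \<zeta> (y l x) + y l (\<zeta> x) = sc th2 x) \<and>
     (\<forall>i\<in>{1..<l}. \<forall>j\<in>{1..l}. j \<noteq> i \<and> j \<noteq> i + 1 \<longrightarrow> \<sigma> i \<circ> y j = y j \<circ> \<sigma> i)"

definition irreducible_Hmod ::
  "(complex \<Rightarrow> 'm::ab_group_add \<Rightarrow> 'm) \<Rightarrow> nat \<Rightarrow> complex \<Rightarrow> complex \<Rightarrow>
   (nat \<Rightarrow> 'm \<Rightarrow> 'm) \<Rightarrow> ('m \<Rightarrow> 'm) \<Rightarrow> (nat \<Rightarrow> 'm \<Rightarrow> 'm) \<Rightarrow> bool" where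
  "irreducible_Hmod sc l th1 th2 \<sigma> \<zeta> y \<longleftrightarrow>
     is_Hmod sc l th1 th2 \<sigma> \<zeta> y \<and> (\<exists>x::'m. x \<noteq> 0) \<and>
     (\<forall>S. is_subspace sc S \<and> (\<forall>i\<in>{1..<l}. \<sigma> i ` S \<subseteq> S) \<and> \<zeta> ` S \<subseteq> S \<and>
          (\<forall>k\<in>{1..l}. y k ` S \<subseteq> S) \<longrightarrow> S = {0} \<or> S = UNIV)"

definition sgnop :: "nat \<Rightarrow> 'a::uminus \<Rightarrow> 'a" where
  "sgnop e x = (if even e then x else - x)"

definition par :: "(nat \<Rightarrow> int) \<Rightarrow> nat \<Rightarrow> nat" where
  "par s i = (if s i = 1 then 0 else 1)"

definition varpi1 :: "nat \<Rightarrow> (nat \<Rightarrow> int) \<Rightarrow> (nat \<Rightarrow> int) \<Rightarrow> int" where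
  "varpi1 \<kappa> s eps = (\<Sum>a\<in>{1..\<kappa>}. s a * eps a)"

definition jmath :: "nat \<Rightarrow> nat \<Rightarrow> complex" where
  "jmath m n = (of_nat m - of_nat n) / 2"

definition dr_idx :: "nat \<Rightarrow> nat \<Rightarrow> nat list set" where
  "dr_idx \<kappa> l = {a. length a = l \<and> set a \<subseteq> {1..\<kappa>}}"

definition Tsp :: "nat \<Rightarrow> nat \<Rightarrow> (nat list \<Rightarrow> 'm::zero) set" where
  "Tsp \<kappa> l = {f. \<forall>a. a \<notin> dr_idx \<kappa> l \<longrightarrow> f a = 0}"

definition scaleT :: "('c \<Rightarrow> 'm \<Rightarrow> 'm) \<Rightarrow> 'c \<Rightarrow> (nat list \<Rightarrow> 'm) \<Rightarrow> (nat list \<Rightarrow> 'm)" where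
  "scaleT sc c f = (\<lambda>a. sc c (f a))"

text \<open>E^{(k)}_{ij}: action of E_{ij} on the k-th tensor factor of V (M is purely even), with Koszul sign.\<close>
definition Eop :: "(nat \<Rightarrow> int) \<Rightarrow> nat \<Rightarrow> nat \<Rightarrow> nat \<Rightarrow> nat \<Rightarrow> nat \<Rightarrow>
                   (nat list \<Rightarrow> 'm::ab_group_add) \<Rightarrow> (nat list \<Rightarrow> 'm)" where
  "Eop s \<kappa> l k i j f = (\<lambda>a. if a \<in> dr_idx \<kappa> l \<and> a ! (k-1) = i
      then sgnop ((par s i + par s j) * (\<Sum>p<k-1. par s (a ! p))) (f (a[k-1 := j])) else 0)"

text \<open>Components of Q^{(k)} = sum_{ij} (-1)^{|i||j|+|i|+|j|} E^{(k)}_{ij} (x) E_{ij}.\<close>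
definition Qop :: "(nat \<Rightarrow> int) \<Rightarrow> nat \<Rightarrow> nat \<Rightarrow> nat \<Rightarrow> nat \<Rightarrow> nat \<Rightarrow>
                   (nat list \<Rightarrow> 'm::ab_group_add) \<Rightarrow> (nat list \<Rightarrow> 'm)" where
  "Qop s \<kappa> l k i j = sgnop (par s i * par s j + par s i + par s j) (Eop s \<kappa> l k i j)"

text \<open>Diagonal action of sigma_k (k < l): sigma_k on M tensored with the super flip
 sum_{a,b} s_b E^{(k)}_{ab} E^{(k+1)}_{ba} of factors k, k+1, which sends
 ... v_c (x) v_d ... to (-1)^{|c||d|} ... v_d (x) v_c ... .\<close>
definition sigmaT :: "(nat \<Rightarrow> int) \<Rightarrow> nat \<Rightarrow> nat \<Rightarrow> (nat \<Rightarrow> 'm \<Rightarrow> 'm) \<Rightarrow> nat \<Rightarrow>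
                   (nat list \<Rightarrow> 'm::ab_group_add) \<Rightarrow> (nat list \<Rightarrow> 'm)" where
  "sigmaT s \<kappa> l \<sigma> k f = (\<lambda>a. if a \<in> dr_idx \<kappa> l
      then sgnop (par s (a ! (k-1)) * par s (a ! k)) (\<sigma> k (f (a[k-1 := a ! k, k := a ! (k-1)])))
      else 0)"

definition varsigmaT :: "(complex \<Rightarrow> 'm \<Rightarrow> 'm) \<Rightarrow> (nat \<Rightarrow> int) \<Rightarrow> nat \<Rightarrow> nat \<Rightarrow> ('m \<Rightarrow> 'm) \<Rightarrow>
                   (nat list \<Rightarrow> 'm::ab_group_add) \<Rightarrow> (nat list \<Rightarrow> 'm)" where
  "varsigmaT sc eps \<kappa> l \<zeta> f = (\<lambda>a. if a \<in> dr_idx \<kappa> l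
      then sc (of_int (eps (a ! (l-1)))) (\<zeta> (f a)) else 0)"

definition yT :: "nat \<Rightarrow> nat \<Rightarrow> (nat \<Rightarrow> 'm \<Rightarrow> 'm) \<Rightarrow> nat \<Rightarrow>
                   (nat list \<Rightarrow> 'm::ab_group_add) \<Rightarrow> (nat list \<Rightarrow> 'm)" where
  "yT \<kappa> l y k f = (\<lambda>a. if a \<in> dr_idx \<kappa> l then y k (f a) else 0)"

definition Ksp :: "(complex \<Rightarrow> 'm \<Rightarrow> 'm) \<Rightarrow> (nat \<Rightarrow> int) \<Rightarrow> (nat \<Rightarrow> int) \<Rightarrow> nat \<Rightarrow> nat \<Rightarrow> int \<Rightarrow>
                   (nat \<Rightarrow> 'm \<Rightarrow> 'm) \<Rightarrow> ('m \<Rightarrow> 'm) \<Rightarrow> (nat list \<Rightarrow> 'm::ab_group_add) set" where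
  "Ksp sc s eps \<kappa> l e \<sigma> \<zeta> = \<Inter>{S. is_subspace (scaleT sc) S \<and>
      (\<forall>k\<in>{1..<l}. \<forall>f\<in>Tsp \<kappa> l. sigmaT s \<kappa> l \<sigma> k f - scaleT sc (of_int e) f \<in> S) \<and>
      (\<forall>f\<in>Tsp \<kappa> l. varsigmaT sc eps \<kappa> l \<zeta> f - scaleT sc (of_int e) f \<in> S)}"

text \<open>A series is X :: nat => nat => nat => op, where X r i j is the coefficient of u^{-r}
 of the (i,j)-component, i.e. X(u) = sum_{r,i,j} X r i j u^{-r} (x) E_{ij}.  All series used
 are even, so the (i,j) component has parity |i|+|j| and the super tensor product gives the
 sign (-1)^{(|i|+|k|)(|k|+|j|)} in the product.\<close>

type_synonym 'm Top = "(nat list \<Rightarrow> 'm) \<Rightarrow> (nat list \<Rightarrow> 'm)"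
type_synonym 'm ser = "nat \<Rightarrow> nat \<Rightarrow> nat \<Rightarrow> 'm Top"

definition one_ser :: "'m::ab_group_add ser" where
  "one_ser = (\<lambda>r i j. if r = 0 \<and> i = j then id else 0)"

definition mmul :: "nat \<Rightarrow> (nat \<Rightarrow> int) \<Rightarrow> 'm::ab_group_add ser \<Rightarrow> 'm ser \<Rightarrow> 'm ser" where
  "mmul \<kappa> s X Y = (\<lambda>r i j. \<Sum>p\<le>r. \<Sum>k\<in>{1..\<kappa>}.
      sgnop ((par s i + par s k) * (par s k + par s j)) (X p i k \<circ> Y (r - p) k j))"

definition mprod :: "nat \<Rightarrow> (nat \<Rightarrow> int) \<Rightarrow> 'm::ab_group_add ser list \<Rightarrow> 'm ser" where
  "mprod \<kappa> s xs = foldr (mmul \<kappa> s) xs one_ser"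

text \<open>(c + Y)^r as an operator; the expansion of (u - c - Y)^{-1} is sum_{r>=1} (c+Y)^{r-1} u^{-r}.\<close>
definition cpow :: "(complex \<Rightarrow> 'm \<Rightarrow> 'm) \<Rightarrow> complex \<Rightarrow> 'm::ab_group_add Top \<Rightarrow> nat \<Rightarrow> 'm Top" where
  "cpow sc c Y r = ((\<lambda>f. scaleT sc c f + Y f) ^^ r)"

text \<open>T_k(u) = 1 + (u - jmath - chi y_k)^{-1} Q^{(k)}.\<close>
definition Tser :: "(complex \<Rightarrow> 'm \<Rightarrow> 'm) \<Rightarrow> (nat \<Rightarrow> int) \<Rightarrow> nat \<Rightarrow> nat \<Rightarrow> nat \<Rightarrow>
                    (nat \<Rightarrow> 'm \<Rightarrow> 'm) \<Rightarrow> complex \<Rightarrow> nat \<Rightarrow> 'm::ab_group_add ser" where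
  "Tser sc s m n l y \<chi> k = (\<lambda>r i j. if r = 0 then (if i = j then id else 0)
      else cpow sc (jmath m n) (\<lambda>f. scaleT sc \<chi> (yT (m+n) l y k f)) (r - 1) \<circ> Qop s (m+n) l k i j)"

text \<open>S_k(-u) = 1 - (-u + jmath - chi y_k)^{-1} Q^{(k)} = 1 + (u - (jmath - chi y_k))^{-1} Q^{(k)}.\<close>
definition Sser :: "(complex \<Rightarrow> 'm \<Rightarrow> 'm) \<Rightarrow> (nat \<Rightarrow> int) \<Rightarrow> nat \<Rightarrow> nat \<Rightarrow> nat \<Rightarrow>
                    (nat \<Rightarrow> 'm \<Rightarrow> 'm) \<Rightarrow> complex \<Rightarrow> nat \<Rightarrow> 'm::ab_group_add ser" where
  "Sser sc s m n l y \<chi> k = (\<lambda>r i j. if r = 0 then (if i = j then id else 0)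
      else cpow sc (jmath m n) (\<lambda>f. scaleT sc (- \<chi>) (yT (m+n) l y k f)) (r - 1) \<circ> Qop s (m+n) l k i j)"

definition Gser :: "(complex \<Rightarrow> 'm \<Rightarrow> 'm) \<Rightarrow> (nat \<Rightarrow> int) \<Rightarrow> complex \<Rightarrow> 'm::ab_group_add ser" where
  "Gser sc eps \<gamma> = (\<lambda>r i j. if i = j \<and> r = 0 then scaleT sc (of_int (eps i))
      else if i = j \<and> r = 1 then scaleT sc \<gamma> else 0)"

text \<open>Action of the generator b_{ij}^{(r)}: B(u) = sum (-1)^{|i||j|+|j|} b_{ij}(u) (x) E_{ij} is
 mapped to T_1(u)...T_l(u)(G+gamma u^{-1})S_l(-u)...S_1(-u).\<close>
definition bgen :: "(complex \<Rightarrow> 'm \<Rightarrow> 'm) \<Rightarrow> (nat \<Rightarrow> int) \<Rightarrow> (nat \<Rightarrow> int) \<Rightarrow> nat \<Rightarrow> nat \<Rightarrow> nat \<Rightarrow>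
                    (nat \<Rightarrow> 'm \<Rightarrow> 'm) \<Rightarrow> complex \<Rightarrow> complex \<Rightarrow> nat \<Rightarrow> nat \<Rightarrow> nat \<Rightarrow> 'm::ab_group_add Top" where
  "bgen sc s eps m n l y \<gamma> \<chi> r i j = sgnop (par s i * par s j + par s j)
     (mprod (m+n) s (map (Tser sc s m n l y \<chi>) [1..<Suc l] @ [Gser sc eps \<gamma>] @
                     map (Sser sc s m n l y \<chi>) (rev [1..<Suc l])) r i j)"

text \<open>D(M) = Tsp / Ksp is 0 or irreducible as a B-module: every subspace W with
 Ksp <= W <= Tsp stable under all generators b_{ij}^{(r)} (r >= 1) equals Ksp or Tsp.\<close>
definition drinfeld_zero_or_irreducible ::
  "(complex \<Rightarrow> 'm \<Rightarrow> 'm) \<Rightarrow> (nat \<Rightarrow> int) \<Rightarrow> (nat \<Rightarrow> int) \<Rightarrow> nat \<Rightarrow> nat \<Rightarrow> nat \<Rightarrow> int \<Rightarrow>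
   complex \<Rightarrow> complex \<Rightarrow> (nat \<Rightarrow> 'm \<Rightarrow> 'm) \<Rightarrow> ('m \<Rightarrow> 'm) \<Rightarrow> (nat \<Rightarrow> 'm::ab_group_add \<Rightarrow> 'm) \<Rightarrow> bool" where
  "drinfeld_zero_or_irreducible sc s eps m n l e \<gamma> \<chi> \<sigma> \<zeta> y \<longleftrightarrow>
     (\<forall>W. is_subspace (scaleT sc) W \<and> Ksp sc s eps (m+n) l e \<sigma> \<zeta> \<subseteq> W \<and> W \<subseteq> Tsp (m+n) l \<and>
        (\<forall>r\<ge>1. \<forall>i\<in>{1..m+n}. \<forall>j\<in>{1..m+n}. \<forall>f\<in>W. bgen sc s eps m n l y \<gamma> \<chi> r i j f \<in> W)
      \<longrightarrow> W = Ksp sc s eps (m+n) l e \<sigma> \<zeta> \<or> W = Tsp (m+n) l)"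

end

theory Submission
  imports Defs "HOL-Combinatorics.Transposition"
begin

text \<open>
Let \<open>W\<close> be a stable subspace strictly containing the subspace \<open>K\<close> that is factored out.  Averaging
over \<open>W\<^sub>l\<close> changes vectors only modulo \<open>K\<close>, so \<open>W\<close> contains a nonzero vector \<open>f\<close> on which \<open>W\<^sub>l\<close>
acts by the character \<open>\<epsilon>\<close>.  Since \<open>M\<close> is irreducible and matrix units generate \<open>End V\<close>, every vector
is obtained from \<open>f\<close> by words in the operators \<open>y\<^sub>c\<^sup>a E\<^sub>i\<^sub>j\<^sup>(\<^sup>c\<^sup>)\<close>, so it suffices that \<open>w f \<in> W\<close> for
every word \<open>w\<close>.  This goes by induction on the degree in the \<open>y\<close>'s and then on the length.  Modulo \<open>K\<close>
and terms of lower degree, \<open>w f\<close> is invariant under renaming the sites of \<open>w\<close>.  If the site of the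
first letter occurs again, the two letters merge.  Otherwise, if \<open>(-1)\<^sup>a \<noteq> \<epsilon>\<^sub>i\<epsilon>\<^sub>j\<close> for the first letter,
a sign change shows that \<open>w f\<close> is congruent to its negative.  Otherwise the generator with
index \<open>a + 1\<close>, whose leading part is \<open>\<chi>\<^sup>a (\<epsilon>\<^sub>j + (-1)\<^sup>a \<epsilon>\<^sub>i) \<Sum>\<^sub>c y\<^sub>c\<^sup>a E\<^sub>i\<^sub>j\<^sup>(\<^sup>c\<^sup>)\<close> with nonzero coefficient, maps the
rest of the word to a nonzero multiple of \<open>w f\<close> plus words already treated.
\<close>

section \<open>Super signs, matrix units and the super flip\<close>

lemma sgnop_apply: "sgnop n f x = sgnop n (f x)"
  by (simp add: sgnop_def)

lemma sgnop_sgnop: "sgnop a (sgnop b x) = sgnop (a + b) (x :: 'a::group_add)"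
  by (auto simp: sgnop_def)

lemma sgnop_cong: "even a = even b \<Longrightarrow> sgnop a x = sgnop b x"
  by (simp add: sgnop_def)

lemma sgnop_zero: "sgnop n 0 = (0 :: 'a::group_add)"
  by (simp add: sgnop_def)

lemma sgnop_add: "sgnop n (x + y) = sgnop n x + sgnop n (y :: 'a::ab_group_add)"
  by (simp add: sgnop_def)

text \<open>Sites of the tensor product count from 1 and list positions from 0, so this exchanges
  the entries at sites \<open>k\<close> and \<open>k + 1\<close>.\<close>

definition swp :: "nat \<Rightarrow> nat list \<Rightarrow> nat list" where
  "swp k a = a[k - 1 := a ! k, k := a ! (k - 1)]"

lemma length_swp [simp]: "length (swp k a) = length a"
  by (simp add: swp_def)

lemma nth_swp:
  assumes "1 \<le> k" "k < length a" "p < length a"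
  shows "swp k a ! p = a ! (transpose (k - 1) k p)"
  using assms by (auto simp: swp_def transpose_def nth_list_update)

lemma set_swp: "\<lbrakk>1 \<le> k; k < length a\<rbrakk> \<Longrightarrow> set (swp k a) = set a"
  unfolding swp_def by (metis less_imp_diff_less set_swap)

lemma sum_fun_apply: "(\<Sum>i\<in>A. f i) x = (\<Sum>i\<in>A. f i x)"
  by (induction A rule: infinite_finite_induct) auto

lemma length_dr_idx: "a \<in> dr_idx \<kappa> l \<Longrightarrow> length a = l"
  by (simp add: dr_idx_def)

lemma swp_dr_idx: "\<lbrakk>1 \<le> k; k < l\<rbrakk> \<Longrightarrow> swp k a \<in> dr_idx \<kappa> l \<longleftrightarrow> a \<in> dr_idx \<kappa> l"
  by (auto simp: dr_idx_def set_swp)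

lemma update_dr_idx: "\<lbrakk>a \<in> dr_idx \<kappa> l; j \<in> {1..\<kappa>}\<rbrakk> \<Longrightarrow> a[p := j] \<in> dr_idx \<kappa> l"
  unfolding dr_idx_def using set_update_subset_insert by fastforce

lemma nth_dr_idx: "\<lbrakk>a \<in> dr_idx \<kappa> l; p < l\<rbrakk> \<Longrightarrow> a ! p \<in> {1..\<kappa>}"
  unfolding dr_idx_def using nth_mem by blast

lemma transpose_less: "\<lbrakk>k < n; p < n\<rbrakk> \<Longrightarrow> transpose (k - 1) k p < (n :: nat)"
  by (auto simp: transpose_def)

lemma swp_swp: "\<lbrakk>1 \<le> k; k < length a\<rbrakk> \<Longrightarrow> swp k (swp k a) = a"
  by (rule nth_equalityI) (simp_all add: nth_swp transpose_less del: One_nat_def)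

lemma swp_braid:
  assumes "1 \<le> k" "k + 1 < length a"
  shows "swp k (swp (k+1) (swp k a)) = swp (k+1) (swp k (swp (k+1) a))"
proof (rule nth_equalityI)
  fix p assume "p < length (swp k (swp (k+1) (swp k a)))"
  then have p: "p < length a" by simp
  obtain q where k: "k = Suc q" using assms by (cases k) auto
  have "transpose q (q+1) (transpose (q+1) (q+2) (transpose q (q+1) p))
    = transpose (q+1) (q+2) (transpose q (q+1) (transpose (q+1) (q+2) p))"
    by (cases "p = q"; cases "p = q+1"; cases "p = q+2") (auto simp: transpose_def)
  then show "swp k (swp (k+1) (swp k a)) ! p = swp (k+1) (swp k (swp (k+1) a)) ! p"
    using assms p transpose_less[of k "length a"] transpose_less[of "k+1" "length a"]
    by (simp add: nth_swp k)
qed simp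

lemma swp_commute:
  assumes "1 \<le> i" "i + 1 < j" "j < length a"
  shows "swp i (swp j a) = swp j (swp i a)"
proof (rule nth_equalityI)
  fix p assume "p < length (swp i (swp j a))"
  then have p: "p < length a" by simp
  have "transpose (i-1) i (transpose (j-1) j p) = transpose (j-1) j (transpose (i-1) i p)"
    using assms
    by (cases "p = i - 1"; cases "p = i"; cases "p = j - 1"; cases "p = j") (auto simp: transpose_def)
  then show "swp i (swp j a) ! p = swp j (swp i a) ! p"
    using assms p transpose_less[of i "length a"] transpose_less[of j "length a"]
    by (simp add: nth_swp del: One_nat_def)
qed simp

text \<open>Needed to carry a matrix unit through the flip: site \<open>c\<close> of
  \<open>swp k a\<close> is fed from site \<open>transpose k (k + 1) c\<close> of \<open>a\<close>.
  The \<open>- 1\<close> converts sites to positions.\<close>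

lemma swp_update:
  assumes "1 \<le> k" "k < length a" "1 \<le> c" "c \<le> length a"
  shows "swp k (a[transpose k (k + 1) c - 1 := j]) = (swp k a)[c - 1 := j]"
proof (rule nth_equalityI)
  fix p assume "p < length (swp k (a[transpose k (k + 1) c - 1 := j]))"
  then have p: "p < length a" by simp
  have "transpose (k - 1) k p < length a" using p assms by (auto simp: transpose_def)
  moreover have "transpose (k - 1) k p = transpose k (k + 1) c - 1 \<longleftrightarrow> p = c - 1"
    using assms by (cases "c = k"; cases "c = k + 1"; cases "p = k"; cases "p = k - 1") auto
  ultimately show "swp k (a[transpose k (k + 1) c - 1 := j]) ! p = (swp k a)[c - 1 := j] ! p"
    using assms p by (subst nth_swp) (auto simp: nth_list_update nth_swp)
qed simp

section \<open>Prefix parities, the exponents in the Koszul signs of \<open>Eop\<close>\<close>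

definition parity_sum :: "(nat \<Rightarrow> int) \<Rightarrow> nat list \<Rightarrow> nat \<Rightarrow> nat" where
  "parity_sum s a q = (\<Sum>p<q. par s (a ! p))"

lemma parity_sum_cong: "(\<And>p. p < q \<Longrightarrow> a ! p = b ! p) \<Longrightarrow> parity_sum s a q = parity_sum s b q"
  by (simp add: parity_sum_def)

lemma parity_sum_update_ge: "q \<le> p \<Longrightarrow> parity_sum s (a[p := j]) q = parity_sum s a q"
  by (rule parity_sum_cong) simp

text \<open>Additive form, because subtraction of natural numbers truncates.\<close>

lemma parity_sum_update_less:
  assumes "p < q" "p < length a"
  shows "parity_sum s (a[p := j]) q + par s (a ! p) = parity_sum s a q + par s j"
proof -
  have "(\<Sum>r\<in>{..<q} - {p}. par s (a[p := j] ! r)) = (\<Sum>r\<in>{..<q} - {p}. par s (a ! r))"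
    by (rule sum.cong) auto
  with assms show ?thesis
    unfolding parity_sum_def by (subst (1 2) sum.remove[of "{..<q}" p]) auto
qed

lemma even_parity_sum_update:
  assumes "p < q" "p < length a"
  shows "even (parity_sum s (a[p := j]) q) \<longleftrightarrow> (even (parity_sum s a q) \<longleftrightarrow> (even (par s j) \<longleftrightarrow> even (par s (a ! p))))"
proof -
  have "even (parity_sum s (a[p := j]) q + par s (a ! p)) = even (parity_sum s a q + par s j)"
    by (simp add: parity_sum_update_less[OF assms])
  then show ?thesis by (auto simp: even_add)
qed

text \<open>Only the prefix of length \<open>k\<close> separates the two exchanged entries: a
  shorter one contains neither, a longer one contains both.\<close>

lemma parity_sum_swp:
  assumes "1 \<le> k" "k < length a" "q \<noteq> k"  "q \<le> length a"
  shows "parity_sum s (swp k a) q = parity_sum s a q"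
proof (cases "q < k")
  case True
  then show ?thesis using assms by (intro parity_sum_cong) (auto simp: nth_swp transpose_def)
next
  case False
  with assms have qk: "k < q" by simp
  have "(\<Sum>p<q. par s (swp k a ! p)) = (\<Sum>p<q. par s (a ! p))"
    by (rule sum.reindex_bij_witness[of _ "transpose (k-1) k" "transpose (k-1) k"])
       (use assms qk in \<open>auto simp: nth_swp transpose_def\<close>)
  then show ?thesis by (simp add: parity_sum_def)
qed

section \<open>Relations between matrix units and the super flip\<close>

lemma Eop_app: "Eop s \<kappa> l k i j f a = (if a \<in> dr_idx \<kappa> l \<and> a ! (k-1) = i
      then sgnop ((par s i + par s j) * parity_sum s a (k - 1)) (f (a[k-1 := j])) else 0)"
  by (simp add: Eop_def parity_sum_def)

lemma sigmaT_app: "sigmaT s \<kappa> l \<sigma> k f a = (if a \<in> dr_idx \<kappa> l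
      then sgnop (par s (a ! (k-1)) * par s (a ! k)) (\<sigma> k (f (swp k a))) else 0)"
  by (simp add: sigmaT_def swp_def)

text \<open>The two orders differ only in what the operator at the later site finds in its prefix at
  the earlier site: the row index in one order, the column index in the other.\<close>

lemma Eop_commute:
  assumes "1 \<le> k" "k \<le> l" "1 \<le> k'" "k' \<le> l" "k \<noteq> k'" "j \<in> {1..\<kappa>}" "j' \<in> {1..\<kappa>}"
  shows "Eop s \<kappa> l k i j (Eop s \<kappa> l k' i' j' f) =
    sgnop ((par s i + par s j) * (par s i' + par s j')) (Eop s \<kappa> l k' i' j' (Eop s \<kappa> l k i j f))"
proof
  fix a
  have ne: "k - 1 \<noteq> k' - 1" using assms by auto
  show "Eop s \<kappa> l k i j (Eop s \<kappa> l k' i' j' f) a =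
    sgnop ((par s i + par s j) * (par s i' + par s j')) (Eop s \<kappa> l k' i' j' (Eop s \<kappa> l k i j f)) a"
  proof (cases "a \<in> dr_idx \<kappa> l \<and> a ! (k - 1) = i \<and> a ! (k' - 1) = i'")
    case True
    then have a: "a \<in> dr_idx \<kappa> l" "a ! (k - 1) = i" "a ! (k' - 1) = i'" and len: "length a = l"
      by (auto simp: dr_idx_def)
    have "k - 1 < k' - 1 \<or> k' - 1 < k - 1" using ne by auto
    then show ?thesis using assms a ne len
      by (auto simp: Eop_app sgnop_apply update_dr_idx sgnop_sgnop list_update_swap[OF ne]
          parity_sum_update_ge even_parity_sum_update simp del: One_nat_def atLeastAtMost_iff intro!: sgnop_cong)
  next
    case False
    then show ?thesis using assms ne
      by (auto simp: Eop_app sgnop_apply update_dr_idx sgnop_zero dr_idx_def)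
  qed
qed

lemma Eop_Eop:
  assumes "1 \<le> k" "k \<le> l" "j \<in> {1..\<kappa>}"
  shows "Eop s \<kappa> l k i j (Eop s \<kappa> l k i' j' f) = (if j = i' then Eop s \<kappa> l k i j' f else 0)"
proof
  fix a
  show "Eop s \<kappa> l k i j (Eop s \<kappa> l k i' j' f) a = (if j = i' then Eop s \<kappa> l k i j' f else 0) a"
    using assms nth_dr_idx[of a \<kappa> l "k - 1"]
    by (cases "a \<in> dr_idx \<kappa> l") (auto simp: Eop_app sgnop_sgnop sgnop_zero parity_sum_update_ge update_dr_idx
      length_dr_idx intro!: sgnop_cong)
qed

lemma Eop_sum_diag:
  assumes "1 \<le> k" "k \<le> l" "f \<in> Tsp \<kappa> l"
  shows "(\<Sum>i\<in>{1..\<kappa>}. Eop s \<kappa> l k i i f) = f"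
proof
  fix a
  have "(\<Sum>i\<in>{1..\<kappa>}. Eop s \<kappa> l k i i f) a = (\<Sum>i\<in>{1..\<kappa>}. if a \<in> dr_idx \<kappa> l \<and> a ! (k-1) = i then f a else 0)"
    unfolding sum_fun_apply by (rule sum.cong) (auto simp: Eop_app sgnop_def)
  also have "\<dots> = f a"
    using assms nth_dr_idx[of a \<kappa> l "k - 1"] by (cases "a \<in> dr_idx \<kappa> l") (auto simp: Tsp_def)
  finally show "(\<Sum>i\<in>{1..\<kappa>}. Eop s \<kappa> l k i i f) a = f a" .
qed

lemma sigmaT_Eop:
  assumes lin: "is_linear sc (\<sigma> k)" and "1 \<le> k" "k < l" "1 \<le> c" "c \<le> l" "j \<in> {1..\<kappa>}"
  shows "sigmaT s \<kappa> l \<sigma> k (Eop s \<kappa> l c i j f) =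
    Eop s \<kappa> l (transpose k (k + 1) c) i j (sigmaT s \<kappa> l \<sigma> k f)"
proof
  fix a
  have add: "\<sigma> k (x + y) = \<sigma> k x + \<sigma> k y" for x y
    using lin by (simp add: is_linear_def)
  have z: "\<sigma> k 0 = 0" using add[of 0 0] by simp
  have "\<sigma> k (- x) = - \<sigma> k x" for x
    using add[of x "- x"] z by (simp add: minus_unique)
  then have sgn: "\<sigma> k (sgnop n x) = sgnop n (\<sigma> k x)" for n x
    by (simp add: sgnop_def)
  let ?c = "transpose k (k + 1) c"
  have c: "1 \<le> ?c" "?c \<le> l" using assms by (auto simp: transpose_def)
  show "sigmaT s \<kappa> l \<sigma> k (Eop s \<kappa> l c i j f) a = Eop s \<kappa> l ?c i j (sigmaT s \<kappa> l \<sigma> k f) a"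
  proof (cases "a \<in> dr_idx \<kappa> l")
    case True
    then have len: "length a = l" by (rule length_dr_idx)
    have nth: "swp k a ! (c - 1) = a ! (?c - 1)" 
      using assms len by (auto simp: nth_swp transpose_def)
    have ss: "swp k (a[?c - 1 := j]) = (swp k a)[c - 1 := j]"
      using swp_update assms len by auto
    have pk: "parity_sum s b k = parity_sum s b (k - 1) + par s (b ! (k - 1))" for b
      using \<open>1 \<le> k\<close> by (cases k) (auto simp: parity_sum_def)
    let ?X = "\<sigma> k (f ((swp k a)[c - 1 := j]))" and ?a = "a[?c - 1 := j]"
    have L: "sigmaT s \<kappa> l \<sigma> k (Eop s \<kappa> l c i j f) a = (if a ! (?c - 1) = i then
        sgnop (par s (a ! (k-1)) * par s (a ! k) + (par s i + par s j) * parity_sum s (swp k a) (c - 1)) ?X else 0)"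
      using True assms by (simp add: sigmaT_app Eop_app swp_dr_idx nth[unfolded One_nat_def] sgn sgnop_sgnop z sgnop_zero)
    have R: "Eop s \<kappa> l ?c i j (sigmaT s \<kappa> l \<sigma> k f) a = (if a ! (?c - 1) = i then
        sgnop ((par s i + par s j) * parity_sum s a (?c - 1) + par s (?a ! (k-1)) * par s (?a ! k)) ?X else 0)"
      using True assms by (simp add: sigmaT_app Eop_app update_dr_idx ss[simplified] sgnop_sgnop)
    have "even (par s (a ! (k-1)) * par s (a ! k) + (par s i + par s j) * parity_sum s (swp k a) (c - 1))
        = even ((par s i + par s j) * parity_sum s a (?c - 1) + par s (?a ! (k-1)) * par s (?a ! k))"
      if i: "a ! (?c - 1) = i"
    proof -
      \<comment> \<open>If \<open>c\<close> is an exchanged site, the flip sign involves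
        \<open>i\<close> on one side and \<open>j\<close> on the other. This compensates for the
        other exchanged entry entering or leaving the prefix. For other sites the prefix parity does
        not change.\<close>
      consider "c = k" | "c = k + 1" | "c \<noteq> k" "c \<noteq> k + 1" by blast
      then show ?thesis
      proof cases
        case 1
        have "parity_sum s (swp k a) (k - 1) = parity_sum s a (k - 1)"
          using assms len by (intro parity_sum_swp) auto
        moreover have "?a ! (k - 1) = a ! (k - 1)" "?a ! k = j" 
          using 1 assms len by auto
        moreover have "a ! k = i" using i 1 by simp
        ultimately show ?thesis using 1 pk[of a] by auto
      next
        case 2
        have "parity_sum s (swp k a) (k - 1) = parity_sum s a (k - 1)"
          using assms len by (intro parity_sum_swp) auto
        moreover have "swp k a ! (k - 1) = a ! k"
          using assms len by (subst nth_swp) auto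
        moreover have "?a ! (k - 1) = j" "?a ! k = a ! k" 
          using 2 assms len by auto
        moreover have "a ! (k - 1) = i" using i 2 by simp
        ultimately show ?thesis using 2 pk[of "swp k a"] by auto
      next
        case 3
        then have "c - 1 \<noteq> k - 1" "c - 1 \<noteq> k" using assms by auto
        moreover from this have "parity_sum s (swp k a) (c - 1) = parity_sum s a (c - 1)"
          using assms len by (intro parity_sum_swp) auto
        ultimately show ?thesis using 3 by (auto simp: transpose_def)
      qed
    qed
    then show ?thesis unfolding L R by (auto intro: sgnop_cong)
  next
    case False
    then show ?thesis by (simp add: sigmaT_app Eop_app)
  qed
qed

section \<open>The operators on the tensor space\<close>

lemma is_linear_add: "is_linear sc f \<Longrightarrow> f (x + y) = f x + f y"
  and is_linear_scale: "is_linear sc f \<Longrightarrow> f (sc c x) = sc c (f x)"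
  by (simp_all add: is_linear_def)

lemma is_linear_zero: "is_linear sc f \<Longrightarrow> f 0 = 0"
  using is_linear_add[of sc f 0 0] by simp

lemma is_linear_minus: "is_linear sc f \<Longrightarrow> f (- x) = - f x"
  using is_linear_add[of sc f x "- x"] is_linear_zero[of sc f] by (simp add: minus_unique)

lemma is_linear_diff: "is_linear sc f \<Longrightarrow> f (x - y) = f x - f y"
  using is_linear_add[of sc f x "- y"] is_linear_minus[of sc f y] by simp

lemma is_linear_sum: "is_linear sc f \<Longrightarrow> f (\<Sum>i\<in>A. g i) = (\<Sum>i\<in>A. f (g i))"
  by (induction A rule: infinite_finite_induct) (simp_all add: is_linear_zero is_linear_add)

lemma is_linear_sgnop: "is_linear sc f \<Longrightarrow> f (sgnop k x) = sgnop k (f x)"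
  by (simp add: sgnop_def is_linear_minus)

lemma is_linear_funpow: "is_linear sc f \<Longrightarrow> is_linear sc (f ^^ k)"
  by (induction k) (simp_all add: is_linear_def)

lemmas is_linear_simps =
  is_linear_add is_linear_scale is_linear_zero is_linear_minus is_linear_diff is_linear_sum is_linear_sgnop

locale hecke_tensor = vector_space sc
  for sc :: "complex \<Rightarrow> 'm::ab_group_add \<Rightarrow> 'm" +
  fixes m n l :: nat and s eps :: "nat \<Rightarrow> int" and e :: int and th1 th2 :: complex
    and \<sigma> :: "nat \<Rightarrow> 'm \<Rightarrow> 'm" and \<zeta> :: "'m \<Rightarrow> 'm" and y :: "nat \<Rightarrow> 'm \<Rightarrow> 'm"
  assumes s_pm: "\<And>i. i \<in> {1..m+n} \<Longrightarrow> s i = 1 \<or> s i = -1"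
    and eps_pm: "\<And>i. i \<in> {1..m+n} \<Longrightarrow> eps i = 1 \<or> eps i = -1"
    and l_pos: "1 \<le> l"
    and e_pm: "e = 1 \<or> e = -1"
    and Hmod: "is_Hmod sc l th1 th2 \<sigma> \<zeta> y"
begin

abbreviation "\<kappa> \<equiv> m + n"
abbreviation T :: "(nat list \<Rightarrow> 'm) set" where "T \<equiv> Tsp \<kappa> l"
abbreviation sT :: "complex \<Rightarrow> (nat list \<Rightarrow> 'm) \<Rightarrow> nat list \<Rightarrow> 'm" where "sT \<equiv> scaleT sc"
abbreviation E :: "nat \<Rightarrow> nat \<Rightarrow> nat \<Rightarrow> (nat list \<Rightarrow> 'm) \<Rightarrow> nat list \<Rightarrow> 'm" where "E \<equiv> Eop s \<kappa> l"
abbreviation Y :: "nat \<Rightarrow> (nat list \<Rightarrow> 'm) \<Rightarrow> nat list \<Rightarrow> 'm" where "Y \<equiv> yT \<kappa> l y"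
abbreviation Sg :: "nat \<Rightarrow> (nat list \<Rightarrow> 'm) \<Rightarrow> nat list \<Rightarrow> 'm" where "Sg \<equiv> sigmaT s \<kappa> l \<sigma>"
abbreviation Zt :: "(nat list \<Rightarrow> 'm) \<Rightarrow> nat list \<Rightarrow> 'm" where "Zt \<equiv> varsigmaT sc eps \<kappa> l \<zeta>"

section \<open>The Hecke relations, applied to vectors\<close>

lemma lin_\<sigma>: "k \<in> {1..<l} \<Longrightarrow> is_linear sc (\<sigma> k)"
  and lin_\<zeta>: "is_linear sc \<zeta>"
  and lin_y: "k \<in> {1..l} \<Longrightarrow> is_linear sc (y k)"
  using Hmod by (auto simp: is_Hmod_def)

lemmas Hmod_rels = Hmod[unfolded is_Hmod_def fun_eq_iff o_apply id_apply]

lemma \<sigma>_\<sigma>: "i \<in> {1..<l} \<Longrightarrow> \<sigma> i (\<sigma> i x) = x"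
  using Hmod_rels[THEN conjunct2, THEN conjunct2, THEN conjunct2, THEN conjunct2, THEN conjunct1] by blast

lemma \<sigma>_braid: "\<lbrakk>1 \<le> i; i + 1 < l\<rbrakk> \<Longrightarrow> \<sigma> i (\<sigma> (i+1) (\<sigma> i x)) = \<sigma> (i+1) (\<sigma> i (\<sigma> (i+1) x))"
  using Hmod_rels[THEN conjunct2, THEN conjunct2, THEN conjunct2, THEN conjunct2, THEN conjunct2, THEN conjunct1] by blast

lemma \<sigma>_commute: "\<lbrakk>i \<in> {1..<l}; j \<in> {1..<l}; i + 1 < j\<rbrakk> \<Longrightarrow> \<sigma> i (\<sigma> j x) = \<sigma> j (\<sigma> i x)"
  using Hmod_rels[THEN conjunct2, THEN conjunct2, THEN conjunct2, THEN conjunct2, THEN conjunct2, THEN conjunct2, THEN conjunct1] by blast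

lemma \<zeta>_\<zeta>: "\<zeta> (\<zeta> x) = x"
  using Hmod_rels[THEN conjunct2, THEN conjunct2, THEN conjunct2, THEN conjunct2, THEN conjunct2, THEN conjunct2, THEN conjunct2, THEN conjunct1] by blast

lemma \<sigma>_\<zeta>: "\<lbrakk>1 \<le> i; i + 1 < l\<rbrakk> \<Longrightarrow> \<sigma> i (\<zeta> x) = \<zeta> (\<sigma> i x)"
  using Hmod_rels[THEN conjunct2, THEN conjunct2, THEN conjunct2, THEN conjunct2, THEN conjunct2, THEN conjunct2, THEN conjunct2, THEN conjunct2, THEN conjunct1] by blast

lemma \<sigma>_\<zeta>_braid: "2 \<le> l \<Longrightarrow> \<sigma> (l-1) (\<zeta> (\<sigma> (l-1) (\<zeta> x))) = \<zeta> (\<sigma> (l-1) (\<zeta> (\<sigma> (l-1) x)))"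
  using Hmod_rels[THEN conjunct2, THEN conjunct2, THEN conjunct2, THEN conjunct2, THEN conjunct2, THEN conjunct2, THEN conjunct2, THEN conjunct2, THEN conjunct2, THEN conjunct1] by blast

lemma y_y: "\<lbrakk>i \<in> {1..l}; j \<in> {1..l}\<rbrakk> \<Longrightarrow> y i (y j x) = y j (y i x)"
  using Hmod_rels[THEN conjunct2, THEN conjunct2, THEN conjunct2, THEN conjunct2, THEN conjunct2, THEN conjunct2, THEN conjunct2, THEN conjunct2, THEN conjunct2, THEN conjunct2, THEN conjunct1] by blast

lemma \<sigma>_y: "i \<in> {1..<l} \<Longrightarrow> \<sigma> i (y i x) - y (i+1) (\<sigma> i x) = sc th1 x"
  using Hmod_rels[THEN conjunct2, THEN conjunct2, THEN conjunct2, THEN conjunct2, THEN conjunct2, THEN conjunct2, THEN conjunct2, THEN conjunct2, THEN conjunct2, THEN conjunct2, THEN conjunct2, THEN conjunct1] by blast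

lemma \<zeta>_y: "i \<in> {1..<l} \<Longrightarrow> \<zeta> (y i x) = y i (\<zeta> x)"
  using Hmod_rels[THEN conjunct2, THEN conjunct2, THEN conjunct2, THEN conjunct2, THEN conjunct2, THEN conjunct2, THEN conjunct2, THEN conjunct2, THEN conjunct2, THEN conjunct2, THEN conjunct2, THEN conjunct2, THEN conjunct1] by blast

lemma \<zeta>_y_l: "\<zeta> (y l x) + y l (\<zeta> x) = sc th2 x"
  using Hmod_rels[THEN conjunct2, THEN conjunct2, THEN conjunct2, THEN conjunct2, THEN conjunct2, THEN conjunct2, THEN conjunct2, THEN conjunct2, THEN conjunct2, THEN conjunct2, THEN conjunct2, THEN conjunct2, THEN conjunct2, THEN conjunct1] by blast

lemma \<sigma>_y_other: "\<lbrakk>i \<in> {1..<l}; j \<in> {1..l}; j \<noteq> i; j \<noteq> i + 1\<rbrakk> \<Longrightarrow> \<sigma> i (y j x) = y j (\<sigma> i x)"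
  using Hmod_rels[THEN conjunct2, THEN conjunct2, THEN conjunct2, THEN conjunct2, THEN conjunct2, THEN conjunct2, THEN conjunct2, THEN conjunct2, THEN conjunct2, THEN conjunct2, THEN conjunct2, THEN conjunct2, THEN conjunct2, THEN conjunct2] by blast

lemma sT_app: "sT c f a = sc c (f a)"
  by (simp add: scaleT_def)

sublocale T: vector_space sT
  by unfold_locales (auto simp: scaleT_def algebra_simps)

section \<open>Commutation relations on the tensor space\<close>

lemma E_in_T [simp]: "E k i j f \<in> T" and Y_in_T [simp]: "Y k f \<in> T"
  and Sg_in_T [simp]: "Sg k f \<in> T" and Zt_in_T [simp]: "Zt f \<in> T"
  by (auto simp: Tsp_def Eop_app yT_def sigmaT_def varsigmaT_def)

lemma T_subspace: "is_subspace sT T"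
  by (auto simp: is_subspace_def Tsp_def scaleT_def)

lemma lin_E: "is_linear sT (E k i j)"
  by (auto simp: is_linear_def Eop_app sT_app sgnop_add fun_eq_iff sgnop_def)

lemma lin_Y: "k \<in> {1..l} \<Longrightarrow> is_linear sT (Y k)"
  using lin_y[of k] by (auto simp: is_linear_def yT_def sT_app fun_eq_iff)

lemma lin_Sg: "k \<in> {1..<l} \<Longrightarrow> is_linear sT (Sg k)"
  using lin_\<sigma>[of k] by (auto simp: is_linear_def sigmaT_app sT_app sgnop_def fun_eq_iff)

lemma lin_Zt: "is_linear sT Zt"
  using lin_\<zeta> by (auto simp: is_linear_def varsigmaT_def sT_app fun_eq_iff algebra_simps)

lemma Y_Y: "\<lbrakk>k \<in> {1..l}; k' \<in> {1..l}\<rbrakk> \<Longrightarrow> Y k (Y k' f) = Y k' (Y k f)"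
  using y_y[of k k'] by (auto simp: yT_def fun_eq_iff)

lemma Y_E: "\<lbrakk>c \<in> {1..l}; j \<in> {1..\<kappa>}\<rbrakk> \<Longrightarrow> Y c (E k i j f) = E k i j (Y c f)"
  using lin_y[of c]
  by (auto simp: yT_def Eop_app update_dr_idx fun_eq_iff is_linear_sgnop is_linear_zero
      simp del: atLeastAtMost_iff)

lemma par_sign: "q \<in> {1..\<kappa>} \<Longrightarrow> sc (of_int (s q)) x = sgnop (par s q) x"
  using s_pm[of q] by (auto simp: par_def sgnop_def)

text \<open>The super flip of the factors \<open>k\<close> and \<open>k + 1\<close>, acting as the
  identity on the module. In this form it visibly preserves every subspace that the matrix units
  preserve.\<close>

definition Flip :: "nat \<Rightarrow> (nat list \<Rightarrow> 'm) \<Rightarrow> nat list \<Rightarrow> 'm" where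
  "Flip k f = (\<Sum>p\<in>{1..\<kappa>}. \<Sum>q\<in>{1..\<kappa>}. sT (of_int (s q)) (E k p q (E (k+1) q p f)))"

lemma Flip_app:
  assumes "k \<in> {1..<l}"
  shows "Flip k f a = (if a \<in> dr_idx \<kappa> l
    then sgnop (par s (a ! (k-1)) * par s (a ! k)) (f (swp k a)) else 0)"
proof (cases "a \<in> dr_idx \<kappa> l")
  case True
  have len: "length a = l" using True by (rule length_dr_idx)
  have in1: "a ! (k-1) \<in> {1..\<kappa>}" "a ! k \<in> {1..\<kappa>}" using nth_dr_idx[OF True] assms by auto
  have pk: "parity_sum s b k = parity_sum s b (k - 1) + par s (b ! (k - 1))" for b
    using assms by (cases k) (auto simp: parity_sum_def)
  have ne: "k - 1 \<noteq> k" "k - 1 < length a" using assms len by auto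
  have "Flip k f a = (\<Sum>p\<in>{1..\<kappa>}. \<Sum>q\<in>{1..\<kappa>}. if a ! (k-1) = p then if a ! k = q then
      sgnop (par s p * par s q) (f (swp k a)) else 0 else 0)"
    unfolding Flip_def sum_fun_apply
  proof (intro sum.cong refl)
    fix p q assume pq: "p \<in> {1..\<kappa>}" "q \<in> {1..\<kappa>}"
    have "sT (of_int (s q)) (E k p q (E (k+1) q p f)) a =
       sgnop (par s q) (E k p q (E (k+1) q p f) a)"
      using pq by (simp add: sT_app par_sign del: atLeastAtMost_iff)
    \<comment> \<open>The operator at site \<open>k + 1\<close> is evaluated at the list whose site
      \<open>k\<close> already carries \<open>q\<close>, so \<open>par s q\<close> enters its prefix
      parity.\<close>
    also have "\<dots> = (if a ! (k-1) = p then if a ! k = q then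
      sgnop (par s q + ((par s p + par s q) * parity_sum s a (k - 1) + (par s q + par s p) * 
         (parity_sum s a (k - 1) + par s q))) (f (swp k a)) else 0 else 0)"
      using True pq ne by (auto simp: Eop_app sgnop_sgnop sgnop_zero update_dr_idx pk parity_sum_update_ge swp_def
         simp del: atLeastAtMost_iff One_nat_def intro!: sgnop_cong)
    also have "\<dots> = (if a ! (k-1) = p then if a ! k = q then
      sgnop (par s p * par s q) (f (swp k a)) else 0 else 0)"
      by (auto intro!: sgnop_cong)
    finally show "sT (of_int (s q)) (E k p q (E (k+1) q p f)) a = (if a ! (k-1) = p then if a ! k = q then
      sgnop (par s p * par s q) (f (swp k a)) else 0 else 0)" .
  qed
  also have "\<dots> = sgnop (par s (a ! (k-1)) * par s (a ! k)) (f (swp k a))"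
    using in1 by (subst sum.swap) simp
  finally show ?thesis using True by simp
next
  case False
  then show ?thesis by (simp add: Flip_def sum_fun_apply sT_app Eop_app)
qed

lemma Sg_E:
  "\<lbrakk>k \<in> {1..<l}; c \<in> {1..l}; j \<in> {1..\<kappa>}\<rbrakk> \<Longrightarrow> Sg k (E c i j f) = E (transpose k (k + 1) c) i j (Sg k f)"
  using sigmaT_Eop[of sc \<sigma> k l c j \<kappa> s i f] lin_\<sigma>[of k] by simp

text \<open>Crossing \<open>y c\<close> leaves the scalar \<open>th1\<close> on the module, while
  the part of \<open>Sg k\<close> acting on the tensor factors remains; hence the bare flip in the
  correction term.\<close>

lemma Sg_Y:
  assumes "k \<in> {1..<l}" "c \<in> {1..l}"
  shows "Sg k (Y c f) = Y (transpose k (k + 1) c) (Sg k f) +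
    sT (if c = k then th1 else if c = k + 1 then - th1 else 0) (Flip k f)"
proof
  fix a
  have ws: "1 \<le> k" "k < l" and lin: "is_linear sc (\<sigma> k)" "is_linear sc (y k)" "is_linear sc (y (k+1))"
     "is_linear sc (y c)"
    using assms lin_\<sigma> lin_y by auto
  have 1: "\<sigma> k (y k x) = y (k+1) (\<sigma> k x) + sc th1 x" for x
    using \<sigma>_y[OF assms(1), of x] by (simp add: algebra_simps)
  \<comment> \<open>\<open>\<sigma> k\<close> is an involution, so applying it to relation 1 at
    \<open>\<sigma> k x\<close> yields the relation for \<open>y (k + 1)\<close>.\<close>
  have 2: "\<sigma> k (y (k+1) x) = y k (\<sigma> k x) - sc th1 x" for x
  proof -
    have "\<sigma> k (\<sigma> k (y k (\<sigma> k x))) = \<sigma> k (y (k+1) x) + sc th1 x"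
      unfolding 1 \<sigma>_\<sigma>[OF assms(1)] is_linear_simps[OF lin(1)] by simp
    then show ?thesis by (simp add: \<sigma>_\<sigma>[OF assms(1)])
  qed
  show "Sg k (Y c f) a = (Y (transpose k (k + 1) c) (Sg k f) +
    sT (if c = k then th1 else if c = k + 1 then - th1 else 0) (Flip k f)) a"
    using lin \<sigma>_y_other[OF assms] assms(1)
    by (auto simp: sigmaT_app yT_def sT_app Flip_app swp_dr_idx[OF ws] 1 2 sgnop_def is_linear_minus
       transpose_def simp del: One_nat_def)
qed

text \<open>The matrix \<open>G\<close> on the last tensor factor, again through matrix units so
  that it preserves what they preserve.\<close>

definition Gop :: "(nat list \<Rightarrow> 'm) \<Rightarrow> nat list \<Rightarrow> 'm" where
  "Gop f = (\<Sum>p\<in>{1..\<kappa>}. sT (of_int (eps p)) (E l p p f))"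

lemma Gop_app: "Gop f a = (if a \<in> dr_idx \<kappa> l then sc (of_int (eps (a ! (l-1)))) (f a) else 0)"
proof (cases "a \<in> dr_idx \<kappa> l")
  case True
  have "a ! (l-1) \<in> {1..\<kappa>}" using nth_dr_idx[OF True] l_pos by auto
  moreover have "Gop f a = (\<Sum>p\<in>{1..\<kappa>}. if p = a ! (l-1) then sc (of_int (eps p)) (f a) else 0)"
    unfolding Gop_def sum_fun_apply using True
    by (intro sum.cong refl) (auto simp: sT_app Eop_app sgnop_def)
  ultimately show ?thesis using True by simp
qed (simp add: Gop_def sum_fun_apply sT_app Eop_app)

text \<open>Conjugating a matrix unit by \<open>G\<close> scales it by \<open>eps i\<close> over
  \<open>eps j\<close>, which is the product because \<open>eps j\<close> is a sign.\<close>

lemma Zt_E: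
  assumes "c \<in> {1..l}" "i \<in> {1..\<kappa>}" "j \<in> {1..\<kappa>}"
  shows "Zt (E c i j f) = sT (if c = l then of_int (eps i * eps j) else 1) (E c i j (Zt f))"
proof
  fix a
  show "Zt (E c i j f) a = sT (if c = l then of_int (eps i * eps j) else 1) (E c i j (Zt f)) a"
  proof (cases "a \<in> dr_idx \<kappa> l \<and> a ! (c - 1) = i")
    case True
    then have a: "a \<in> dr_idx \<kappa> l" "a ! (c - 1) = i" and len: "length a = l" by (auto simp: dr_idx_def)
    have "eps i * (eps j * eps j) = eps i" using eps_pm[OF assms(3)] by auto
    then have ee: "(of_int (eps i) :: complex) * (of_int (eps j) * of_int (eps j)) = of_int (eps i)"
      by (metis of_int_mult)
    have "c \<noteq> l \<Longrightarrow> c - 1 \<noteq> l - 1" using assms by auto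
    then show ?thesis using a assms len ee l_pos
      by (auto simp: varsigmaT_def Eop_app update_dr_idx sT_app sgnop_def
         is_linear_simps[OF lin_\<zeta>] mult.assoc simp del: One_nat_def atLeastAtMost_iff)
  qed (auto simp: varsigmaT_def Eop_app sT_app is_linear_simps[OF lin_\<zeta>])
qed

text \<open>The scalar \<open>th2\<close> from the relation of \<open>\<zeta>\<close> with
  \<open>y l\<close> comes with \<open>G\<close>, the part of \<open>Zt\<close> that acts on the
  last tensor factor.\<close>

lemma Zt_Y:
  assumes "c \<in> {1..l}"
  shows "Zt (Y c f) = sT (if c = l then -1 else 1) (Y c (Zt f)) + sT (if c = l then th2 else 0) (Gop f)"
proof
  fix a
  have 1: "\<zeta> (y l x) = sc th2 x - y l (\<zeta> x)" for x
    using \<zeta>_y_l[of x] by (simp add: algebra_simps)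
  have 2: "c \<noteq> l \<Longrightarrow> \<zeta> (y c x) = y c (\<zeta> x)" for x
    using \<zeta>_y[of c] assms by auto
  show "Zt (Y c f) a = (sT (if c = l then -1 else 1) (Y c (Zt f)) +
      sT (if c = l then th2 else 0) (Gop f)) a"
    using lin_y[OF assms]
    by (cases "c = l") (simp_all add: varsigmaT_def yT_def sT_app Gop_app 1 2 is_linear_scale
        scale_right_diff_distrib mult.commute)
qed

section \<open>The Coxeter relations of type B on the tensor space\<close>

lemma T_cong: "\<lbrakk>f \<in> T; g \<in> T; \<And>a. a \<in> dr_idx \<kappa> l \<Longrightarrow> f a = g a\<rbrakk> \<Longrightarrow> f = g"
  by (auto simp: Tsp_def fun_eq_iff) metis

lemma Sg_Sg:
  assumes "k \<in> {1..<l}" "f \<in> T" shows "Sg k (Sg k f) = f"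
proof (rule T_cong)
  fix a assume a: "a \<in> dr_idx \<kappa> l"
  then show "Sg k (Sg k f) a = f a"
    using assms(1) lin_\<sigma>[OF assms(1)] \<sigma>_\<sigma>[OF assms(1)] length_dr_idx[OF a]
    by (auto simp: sigmaT_app swp_dr_idx swp_swp nth_swp is_linear_sgnop sgnop_sgnop  intro: sgnop_cong
       simp del: One_nat_def) (auto simp: sgnop_def)
qed (use assms in auto)

lemma Sg_braid:
  assumes "1 \<le> k" "k + 1 < l"
  shows "Sg k (Sg (k+1) (Sg k f)) = Sg (k+1) (Sg k (Sg (k+1) f))"
proof (rule T_cong)
  fix a assume a: "a \<in> dr_idx \<kappa> l"
  obtain q where k: "k = Suc q" using assms by (cases k) auto
  have len: "length a = l" using a by (rule length_dr_idx)
  have lin: "is_linear sc (\<sigma> k)" "is_linear sc (\<sigma> (k+1))" using lin_\<sigma> assms by auto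
  show "Sg k (Sg (k+1) (Sg k f)) a = Sg (k+1) (Sg k (Sg (k+1) f)) a"
    using assms a len lin \<sigma>_braid[OF assms] swp_braid[of k a]
    by (auto simp: k sigmaT_app swp_dr_idx nth_swp is_linear_sgnop sgnop_sgnop transpose_def
       intro!: sgnop_cong)
qed auto

lemma Sg_commute:
  assumes "1 \<le> i" "i + 1 < j" "j < l"
  shows "Sg i (Sg j f) = Sg j (Sg i f)"
proof (rule T_cong)
  fix a assume a: "a \<in> dr_idx \<kappa> l"
  have len: "length a = l" using a by (rule length_dr_idx)
  have lin: "is_linear sc (\<sigma> i)" "is_linear sc (\<sigma> j)" using lin_\<sigma> assms by auto
  have "j - 1 \<noteq> i" "j - 1 \<noteq> i - 1" "j \<noteq> i" "j \<noteq> i - 1" using assms by auto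
  then have "swp i a ! j = a ! j" "swp i a ! (j - 1) = a ! (j - 1)"
     "swp j a ! i = a ! i" "swp j a ! (i - 1) = a ! (i - 1)" using assms len
    by (auto simp: swp_def)
  then show "Sg i (Sg j f) a = Sg j (Sg i f) a"
    using assms a len lin \<sigma>_commute[of i j] swp_commute[of i j a]
    by (auto simp: sigmaT_app swp_dr_idx is_linear_sgnop sgnop_sgnop 
       intro!: sgnop_cong simp del: One_nat_def)
qed auto

lemma eps_sq: "i \<in> {1..\<kappa>} \<Longrightarrow> (of_int (eps i) :: complex) * of_int (eps i) = 1"
  using eps_pm[of i] by auto

lemma Zt_Zt:
  assumes "f \<in> T" shows "Zt (Zt f) = f"
proof (rule T_cong)
  fix a assume a: "a \<in> dr_idx \<kappa> l"
  then have "a ! (l-1) \<in> {1..\<kappa>}" using nth_dr_idx[OF a] l_pos by auto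
  from eps_sq[OF this] show "Zt (Zt f) a = f a"
    using a by (simp add: varsigmaT_def is_linear_simps[OF lin_\<zeta>] \<zeta>_\<zeta>)
qed (use assms in auto)

lemma Sg_Zt:
  assumes "1 \<le> k" "k + 1 < l" shows "Sg k (Zt f) = Zt (Sg k f)"
proof (rule T_cong)
  fix a assume a: "a \<in> dr_idx \<kappa> l"
  have len: "length a = l" using a by (rule length_dr_idx)
  have "l - 1 \<noteq> k" "l - 1 \<noteq> k - 1" using assms by auto
  then have "swp k a ! (l - 1) = a ! (l - 1)" by (simp add: swp_def)
  then show "Sg k (Zt f) a = Zt (Sg k f) a"
    using assms a len lin_\<sigma>[of k] \<sigma>_\<zeta>[OF assms]
    by (auto simp: varsigmaT_def sigmaT_app swp_dr_idx is_linear_simps[OF lin_\<zeta>] is_linear_scale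
        is_linear_sgnop simp del: One_nat_def) (auto simp: sgnop_def)
qed auto

lemma Sg_Zt_braid:
  assumes "2 \<le> l" shows "Sg (l-1) (Zt (Sg (l-1) (Zt f))) = Zt (Sg (l-1) (Zt (Sg (l-1) f)))"
proof (rule T_cong)
  fix a assume a: "a \<in> dr_idx \<kappa> l"
  obtain q where l: "l = Suc (Suc q)" using assms by (cases l; cases "l - 1") auto
  have len: "length a = l" using a by (rule length_dr_idx)
  have ss: "swp (Suc q) (swp (Suc q) a) = a" using l len by (simp add: swp_swp)
  show "Sg (l-1) (Zt (Sg (l-1) (Zt f))) a = Zt (Sg (l-1) (Zt (Sg (l-1) f))) a"
    using assms a len lin_\<sigma>[of "l-1"] \<sigma>_\<zeta>_braid[OF assms]
    by (auto simp: l varsigmaT_def sigmaT_app swp_dr_idx is_linear_simps[OF lin_\<zeta>] is_linear_scale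
        is_linear_sgnop nth_swp ss mult.commute) (auto simp: sgnop_def)
qed auto

end

section \<open>Averaging over the hyperoctahedral group\<close>

lemma (in vector_space) is_subspace_iff: "is_subspace scale S \<longleftrightarrow> subspace S"
  by (auto simp: is_subspace_def subspace_def)

lemma upt_append_upt: "\<lbrakk>i \<le> j; j \<le> k\<rbrakk> \<Longrightarrow> [i..<k] = [i..<j] @ [j..<k]"
  by (metis le_add_diff_inverse upt_add_eq_append)

text \<open>The relations are required only on \<open>T\<close>, because the operators on
  coefficient functions cut off at inadmissible lists and so are involutions only there. The
  character is trivial here; the sign is absorbed into the operators when the locale is
  interpreted.\<close>

locale hyperoctahedral_action = vector_space sc
  for sc :: "complex \<Rightarrow> 'v::ab_group_add \<Rightarrow> 'v" +
  fixes T :: "'v set" and l :: nat and t :: "nat \<Rightarrow> 'v \<Rightarrow> 'v" and z :: "'v \<Rightarrow> 'v"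
  assumes subspace_T: "subspace T"
    and l_pos: "1 \<le> l"
    and lin_t: "i \<in> {1..<l} \<Longrightarrow> is_linear sc (t i)"
    and lin_z: "is_linear sc z"
    and t_in: "\<lbrakk>i \<in> {1..<l}; x \<in> T\<rbrakk> \<Longrightarrow> t i x \<in> T"
    and z_in: "x \<in> T \<Longrightarrow> z x \<in> T"
    and t_t: "\<lbrakk>i \<in> {1..<l}; x \<in> T\<rbrakk> \<Longrightarrow> t i (t i x) = x"
    and t_braid: "\<lbrakk>1 \<le> i; i + 1 < l; x \<in> T\<rbrakk> \<Longrightarrow> t i (t (i+1) (t i x)) = t (i+1) (t i (t (i+1) x))"
    and t_commute': "\<lbrakk>1 \<le> i; i + 1 < j; j < l; x \<in> T\<rbrakk> \<Longrightarrow> t i (t j x) = t j (t i x)"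
    and z_z: "x \<in> T \<Longrightarrow> z (z x) = x"
    and t_z: "\<lbrakk>1 \<le> i; i + 1 < l; x \<in> T\<rbrakk> \<Longrightarrow> t i (z x) = z (t i x)"
    and t_z_braid: "\<lbrakk>2 \<le> l; x \<in> T\<rbrakk> \<Longrightarrow> t (l-1) (z (t (l-1) (z x))) = z (t (l-1) (z (t (l-1) x)))"
begin

lemma t_commute:
  "\<lbrakk>i \<in> {1..<l}; j \<in> {1..<l}; i + 1 < j \<or> j + 1 < i; x \<in> T\<rbrakk> \<Longrightarrow> t i (t j x) = t j (t i x)"
  using t_commute'[of i j x] t_commute'[of j i x] by auto

lemma foldr_t_in: "\<lbrakk>set xs \<subseteq> {1..<l}; x \<in> T\<rbrakk> \<Longrightarrow> foldr t xs x \<in> T"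
  by (induction xs) (auto intro: t_in)

lemma lin_foldr_t: "set xs \<subseteq> {1..<l} \<Longrightarrow> is_linear sc (foldr t xs)"
proof (induction xs)
  case (Cons a xs)
  then have "is_linear sc (t a)" "is_linear sc (foldr t xs)" by (auto intro: lin_t)
  then show ?case by (simp add: is_linear_def)
qed (simp add: is_linear_def)

lemma t_foldr_commute:
  "\<lbrakk>i \<in> {1..<l}; set xs \<subseteq> {1..<l}; \<And>j. j \<in> set xs \<Longrightarrow> i + 1 < j \<or> j + 1 < i; x \<in> T\<rbrakk> \<Longrightarrow>
    t i (foldr t xs x) = foldr t xs (t i x)"
proof (induction xs)
  case (Cons j xs)
  have "t i (t j (foldr t xs x)) = t j (t i (foldr t xs x))"
    using Cons.prems by (intro t_commute foldr_t_in) auto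
  also have "t i (foldr t xs x) = foldr t xs (t i x)"
    using Cons.prems by (intro Cons.IH) auto
  finally show ?case by simp
qed simp

text \<open>The words \<open>t\<^sub>j \<dots> t\<^sub>k\<close> run over coset representatives of \<open>S\<^sub>k\<close> in \<open>S\<^sub>k\<^sub>+\<^sub>1\<close>; left
  multiplication by \<open>t\<^sub>i\<close> permutes the cosets.\<close>
lemma t_foldr_upt:
  assumes i: "1 \<le> i" "i \<le> k" and k: "k < l" and j: "1 \<le> j" "j \<le> k + 1" and g: "g \<in> T"
    and inv: "\<And>i. \<lbrakk>1 \<le> i; i < k\<rbrakk> \<Longrightarrow> t i g = g"
  shows "t i (foldr t [j..<k+1] g) = foldr t [transpose i (i+1) j..<k+1] g"
proof -
  consider "i + 1 < j" | "j = i + 1" | "j = i" | "j < i" by linarith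
  then show ?thesis
  proof cases
    case 1
    then have "t i (foldr t [j..<k+1] g) = foldr t [j..<k+1] (t i g)"
      using assms by (intro t_foldr_commute) auto
    then show ?thesis using 1 inv[of i] assms by auto
  next
    case 2
    then show ?thesis using i by (simp add: upt_conv_Cons del: upt_Suc)
  next
    case 3
    have "foldr t [i+1..<k+1] g \<in> T" using assms by (intro foldr_t_in) auto
    moreover have "[j..<k+1] = i # [i+1..<k+1]" using 3 i by (simp add: upt_conv_Cons del: upt_Suc)
    ultimately show ?thesis using 3 i k by (simp add: t_t del: upt_Suc)
  next
    \<comment> \<open>\<open>t i\<close> passes the letters below \<open>i - 1\<close>. The braid
      relation then leaves a letter \<open>t (i-1)\<close> at the right, which passes the remaining
      letters and is absorbed by \<open>g\<close>, so the word comes out unchanged.\<close>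
    case 4
    have "[j..<k+1] = [j..<i-1] @ [i-1..<k+1]" using 4 i by (intro upt_append_upt) auto
    also have "[i-1..<k+1] = (i-1) # i # [i+1..<k+1]"
      using 4 i by (simp add: upt_conv_Cons del: upt_Suc)
    finally have spl: "[j..<k+1] = [j..<i-1] @ [i-1, i] @ [i+1..<k+1]" by simp
    let ?h = "foldr t [i+1..<k+1] g"
    have h: "?h \<in> T" using assms by (intro foldr_t_in) auto
    have i1: "i - 1 \<in> {1..<l}" "i \<in> {1..<l}" using 4 assms by auto
    have "t i (foldr t [j..<k+1] g) = t i (foldr t [j..<i-1] (t (i-1) (t i ?h)))"
      unfolding spl by simp
    also have "\<dots> = foldr t [j..<i-1] (t i (t (i-1) (t i ?h)))"
      using assms h i1 by (intro t_foldr_commute t_in) auto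
    also have "t i (t (i-1) (t i ?h)) = t (i-1) (t i (t (i-1) ?h))"
      using t_braid[of "i-1" ?h] i1 h by auto
    also have "t (i-1) ?h = foldr t [i+1..<k+1] (t (i-1) g)"
      using assms i1 by (intro t_foldr_commute) auto
    also have "t (i-1) g = g" using i1 i by (intro inv) auto
    finally show ?thesis using 4 spl by (simp add: transpose_def del: upt_Suc)
  qed
qed

text \<open>The average over a symmetric group, built along the chain of symmetric groups: each step
  averages over the \<open>k + 1\<close> cosets of the previous group.\<close>

fun symmetrizer :: "nat \<Rightarrow> 'v \<Rightarrow> 'v" where
  "symmetrizer 0 x = x"
| "symmetrizer (Suc k) x = sc (1 / of_nat (Suc k)) (\<Sum>j\<in>{1..k+1}. foldr t [j..<k+1] (symmetrizer k x))"

lemma symmetrizer_in: "\<lbrakk>k \<le> l; x \<in> T\<rbrakk> \<Longrightarrow> symmetrizer k x \<in> T"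
  by (induction k) (auto intro!: subspace_scale subspace_sum subspace_T foldr_t_in simp del: upt_Suc sum.cl_ivl_Suc)

text \<open>\<open>t i\<close> permutes the summands by the transposition of \<open>i\<close> and
  \<open>i + 1\<close>, so the sum is reindexed.\<close>

lemma t_symmetrizer: "\<lbrakk>k \<le> l; x \<in> T; 1 \<le> i; i < k\<rbrakk> \<Longrightarrow> t i (symmetrizer k x) = symmetrizer k x"
proof (induction k arbitrary: i)
  case (Suc k)
  have g: "symmetrizer k x \<in> T" using Suc by (intro symmetrizer_in) auto
  have inv: "t i (symmetrizer k x) = symmetrizer k x" if "1 \<le> i" "i < k" for i
    using that Suc by simp
  have lin: "is_linear sc (t i)" using Suc by (intro lin_t) auto
  have "(\<Sum>j\<in>{1..k+1}. t i (foldr t [j..<k+1] (symmetrizer k x)))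
    = (\<Sum>j\<in>{1..k+1}. foldr t [transpose i (i+1) j..<k+1] (symmetrizer k x))"
    using Suc g inv by (intro sum.cong refl t_foldr_upt) auto
  also have "\<dots> = (\<Sum>j\<in>{1..k+1}. foldr t [j..<k+1] (symmetrizer k x))"
    using Suc.prems
    by (intro sum.reindex_bij_witness[of _ "transpose i (i+1)" "transpose i (i+1)"])
       (auto simp: transpose_def)
  finally show ?case
    by (simp add: is_linear_scale[OF lin] is_linear_sum[OF lin] del: upt_Suc sum.cl_ivl_Suc)
qed simp

section \<open>Sign changes at single sites\<close>

text \<open>The conjugate of \<open>z\<close> that acts as the sign change at site \<open>k\<close>.\<close>
definition site_sign :: "nat \<Rightarrow> 'v \<Rightarrow> 'v" where
  "site_sign k x = foldr t [k..<l] (z (foldr t (rev [k..<l]) x))"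

lemma site_sign_l: "site_sign l x = z x"
  by (simp add: site_sign_def)

text \<open>The recursion behind the inductions below, which descend from site
  \<open>l\<close>.\<close>

lemma site_sign_step: "k < l \<Longrightarrow> site_sign k x = t k (site_sign (Suc k) (t k x))"
  by (simp add: site_sign_def upt_conv_Cons)

lemma site_sign_in: "\<lbrakk>1 \<le> k; x \<in> T\<rbrakk> \<Longrightarrow> site_sign k x \<in> T"
  unfolding site_sign_def by (intro foldr_t_in z_in) auto

lemma lin_site_sign: "1 \<le> k \<Longrightarrow> is_linear sc (site_sign k)"
  using lin_foldr_t[of "[k..<l]"] lin_foldr_t[of "rev [k..<l]"] lin_z
  unfolding site_sign_def by (auto simp: is_linear_def)

lemma site_sign_site_sign: "\<lbrakk>k \<le> l; 1 \<le> k; x \<in> T\<rbrakk> \<Longrightarrow> site_sign k (site_sign k x) = x"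
proof (induction k arbitrary: x rule: inc_induct)
  case base
  then show ?case by (simp add: site_sign_l z_z)
next
  case (step k)
  then show ?case by (simp add: site_sign_step t_t t_in site_sign_in)
qed

lemma t_site_sign_less: "\<lbrakk>k \<le> l; 1 \<le> i; i + 1 < k; x \<in> T\<rbrakk> \<Longrightarrow> t i (site_sign k x) = site_sign k (t i x)"
proof (induction k arbitrary: x rule: inc_induct)
  case base
  then show ?case by (simp add: site_sign_l t_z)
next
  case (step k)
  then show ?case by (simp add: site_sign_step t_commute[of i k] t_in site_sign_in)
qed

text \<open>One braid relation turns \<open>t (k+1)\<close> into a letter \<open>t k\<close> next to
  the sign change at site \<open>k + 2\<close>, with which it commutes; a second one turns it back
  on the other side.\<close>

lemma t_site_sign_Suc:
  assumes "1 \<le> k" "k + 1 < l" "x \<in> T"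
  shows "t (k+1) (site_sign k x) = site_sign k (t (k+1) x)"
proof -
  have e: "site_sign k x = t k (t (k+1) (site_sign (k+2) (t (k+1) (t k x))))" for x
    using assms by (simp add: site_sign_step)
  have "t (k+1) (site_sign k x) = t k (t (k+1) (t k (site_sign (k+2) (t (k+1) (t k x)))))"
    unfolding e using assms by (simp add: t_braid[simplified] t_in site_sign_in)
  also have "t k (site_sign (k+2) (t (k+1) (t k x))) = site_sign (k+2) (t k (t (k+1) (t k x)))"
    using assms by (intro t_site_sign_less t_in) auto
  also have "t k (t (k+1) (t k x)) = t (k+1) (t k (t (k+1) x))"
    using assms by (intro t_braid) auto
  finally show ?thesis unfolding e .
qed

lemma t_site_sign_greater: "\<lbrakk>k \<le> l; 1 \<le> k; k < i; i < l; x \<in> T\<rbrakk> \<Longrightarrow> t i (site_sign k x) = site_sign k (t i x)"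
proof (induction k arbitrary: x rule: inc_induct)
  case (step k)
  show ?case
  proof (cases "i = k + 1")
    case True
    then show ?thesis using step t_site_sign_Suc[of k x] by auto
  next
    case False
    then show ?thesis using step by (simp add: site_sign_step t_commute[of i k] t_in site_sign_in)
  qed
qed simp

lemma t_site_sign:
  assumes "i \<in> {1..<l}" "k \<in> {1..l}" "x \<in> T"
  shows "t i (site_sign k x) = site_sign (transpose i (i+1) k) (t i x)"
proof -
  consider "i + 1 < k" | "k = i + 1" | "k = i" | "k < i" by linarith
  then show ?thesis
  proof cases
    case 1
    then show ?thesis using t_site_sign_less[of k i x] assms by auto
  next
    case 2
    then show ?thesis using assms by (simp add: site_sign_step t_t)
  next
    case 3
    then show ?thesis using assms by (simp add: site_sign_step t_t site_sign_in t_in)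
  next
    case 4
    then show ?thesis using t_site_sign_greater[of k i x] assms by (auto simp: transpose_def)
  qed
qed

text \<open>The neighbouring site \<open>l - 1\<close> is the relation of length four of type B. For
  lower sites the conjugating letters commute with \<open>z\<close>.\<close>

lemma z_site_sign: "\<lbrakk>k \<le> l - 1; 1 \<le> k; x \<in> T\<rbrakk> \<Longrightarrow> z (site_sign k x) = site_sign k (z x)"
proof (induction k arbitrary: x rule: inc_induct)
  case base
  then have "2 \<le> l" by auto
  moreover from this have "site_sign (l-1) x = t (l-1) (z (t (l-1) x))" for x
    by (simp add: site_sign_step site_sign_l)
  ultimately show ?case using t_z_braid[of x] base by simp
next
  case (step k)
  then have "z (t k x) = t k (z x)" if "x \<in> T" for x using t_z[of k x] that by auto
  then show ?case using step by (simp add: site_sign_step t_in site_sign_in)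
qed

lemma site_sign_commute_less: "\<lbrakk>k \<le> l; 1 \<le> j; j < k; x \<in> T\<rbrakk> \<Longrightarrow> site_sign k (site_sign j x) = site_sign j (site_sign k x)"
proof (induction k arbitrary: x rule: inc_induct)
  case base
  then show ?case using z_site_sign[of j x] by (simp add: site_sign_l)
next
  case (step k)
  have "t k (site_sign j x) = site_sign j (t k x)" if "x \<in> T" for x
    using step that by (intro t_site_sign_greater) auto
  then show ?case using step by (simp add: site_sign_step t_in site_sign_in)
qed

lemma site_sign_commute: "\<lbrakk>k \<in> {1..l}; j \<in> {1..l}; x \<in> T\<rbrakk> \<Longrightarrow> site_sign k (site_sign j x) = site_sign j (site_sign k x)"
  using site_sign_commute_less[of k j x] site_sign_commute_less[of j k x] by (cases j k rule: linorder_cases) auto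

text \<open>The projection onto the vectors fixed by the sign change at \<open>k\<close>. The
  product over all sites averages over the subgroup of all sign changes.\<close>

definition sign_average :: "nat \<Rightarrow> 'v \<Rightarrow> 'v" where
  "sign_average k x = sc (1/2) (x + site_sign k x)"

lemma sign_average_in: "\<lbrakk>1 \<le> k; x \<in> T\<rbrakk> \<Longrightarrow> sign_average k x \<in> T"
  unfolding sign_average_def by (intro subspace_scale subspace_add subspace_T site_sign_in)

lemma foldr_sign_average_in: "\<lbrakk>set xs \<subseteq> {1..l}; x \<in> T\<rbrakk> \<Longrightarrow> foldr sign_average xs x \<in> T"
  by (induction xs) (auto intro: sign_average_in)

lemma site_sign_sign_average: "\<lbrakk>k \<in> {1..l}; j \<in> {1..l}; x \<in> T\<rbrakk> \<Longrightarrow> site_sign k (sign_average j x) = sign_average j (site_sign k x)"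
  by (simp add: sign_average_def is_linear_simps[OF lin_site_sign] site_sign_commute)

lemma sign_average_commute: "\<lbrakk>k \<in> {1..l}; j \<in> {1..l}; x \<in> T\<rbrakk> \<Longrightarrow> sign_average k (sign_average j x) = sign_average j (sign_average k x)"
  by (simp add: sign_average_def[of k] is_linear_simps[OF lin_site_sign] site_sign_sign_average)
     (simp add: sign_average_def is_linear_simps[OF lin_site_sign] site_sign_commute algebra_simps)

lemma t_sign_average:
  "\<lbrakk>i \<in> {1..<l}; k \<in> {1..l}; x \<in> T\<rbrakk> \<Longrightarrow> t i (sign_average k x) = sign_average (transpose i (i+1) k) (t i x)"
  using is_linear_simps[OF lin_t[of i]] by (simp add: sign_average_def t_site_sign)

lemma t_foldr_sign_average:
  "\<lbrakk>i \<in> {1..<l}; set xs \<subseteq> {1..l}; i \<notin> set xs; i + 1 \<notin> set xs; x \<in> T\<rbrakk> \<Longrightarrow>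
    t i (foldr sign_average xs x) = foldr sign_average xs (t i x)"
  by (induction xs) (auto simp: t_sign_average foldr_sign_average_in transpose_def)

text \<open>\<open>t i\<close> exchanges the averages at sites \<open>i\<close> and
  \<open>i + 1\<close>, which commute, and passes all others. Hence averaging over signs keeps
  invariance under permutations.\<close>

lemma t_foldr_sign_average_all:
  assumes i: "i \<in> {1..<l}" and x: "x \<in> T"
  shows "t i (foldr sign_average [1..<Suc l] x) = foldr sign_average [1..<Suc l] (t i x)"
proof -
  have "[1..<Suc l] = [1..<i] @ [i..<Suc l]"
    using i by (intro upt_append_upt) auto
  also have "[i..<Suc l] = i # (i+1) # [i+2..<Suc l]"
    using i by (simp add: upt_conv_Cons del: upt_Suc)
  finally have spl: "[1..<Suc l] = [1..<i] @ [i, i+1] @ [i+2..<Suc l]" by simp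
  let ?h = "foldr sign_average [i+2..<Suc l] x" and ?h' = "foldr sign_average [i+2..<Suc l] (t i x)"
  have h: "?h \<in> T" using x by (intro foldr_sign_average_in) auto
  have th: "t i ?h = ?h'" using i x by (intro t_foldr_sign_average) auto
  have h': "?h' \<in> T" using x i by (intro foldr_sign_average_in t_in) auto
  have "t i (foldr sign_average [1..<i] (sign_average i (sign_average (i+1) ?h))) = foldr sign_average [1..<i] (t i (sign_average i (sign_average (i+1) ?h)))"
    using i h by (intro t_foldr_sign_average sign_average_in) auto
  also have "t i (sign_average i (sign_average (i+1) ?h)) = sign_average (i+1) (sign_average i ?h')"
    using i h th by (simp add: t_sign_average sign_average_in)
  also have "\<dots> = sign_average i (sign_average (i+1) ?h')"
    using i h' by (intro sign_average_commute) auto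
  finally show ?thesis unfolding spl by simp
qed

lemma z_foldr_sign_average: "\<lbrakk>set xs \<subseteq> {1..l}; x \<in> T\<rbrakk> \<Longrightarrow> z (foldr sign_average xs x) = foldr sign_average xs (z x)"
proof (induction xs)
  case (Cons k xs)
  then have "site_sign l (sign_average k (foldr sign_average xs x)) = sign_average k (site_sign l (foldr sign_average xs x))"
    using l_pos by (intro site_sign_sign_average foldr_sign_average_in) auto
  with Cons show ?case by (simp add: site_sign_l)
qed simp

lemma z_foldr_sign_average_all:
  assumes "x \<in> T" shows "z (foldr sign_average [1..<Suc l] x) = foldr sign_average [1..<Suc l] x"
proof -
  have "z (sign_average l x) = sign_average l x"
    using assms site_sign_site_sign[of l x] l_pos by (simp add: sign_average_def site_sign_l is_linear_simps[OF lin_z] z_z add.commute)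
  \<comment> \<open>The average at site \<open>l\<close> is applied first, so it absorbs
    \<open>z\<close> once \<open>z\<close> has passed the others.\<close>
  moreover have "[1..<Suc l] = [1..<l] @ [l]" using l_pos by simp
  ultimately show ?thesis using assms l_pos
    by (simp add: z_foldr_sign_average sign_average_in subset_iff del: upt_Suc)
qed

section \<open>Averaging stays within a coset of a subspace containing all \<open>t i x - x\<close>
  and \<open>z x - x\<close>\<close>

context
  fixes K
  assumes K: "subspace K" and tK: "\<And>i x. \<lbrakk>i \<in> {1..<l}; x \<in> T\<rbrakk> \<Longrightarrow> t i x - x \<in> K"
    and zK: "\<And>x. x \<in> T \<Longrightarrow> z x - x \<in> K"
begin

lemma foldr_t_K: "\<lbrakk>set xs \<subseteq> {1..<l}; x \<in> T\<rbrakk> \<Longrightarrow> foldr t xs x - x \<in> K"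
proof (induction xs)
  case (Cons i xs)
  have "(t i (foldr t xs x) - foldr t xs x) + (foldr t xs x - x) \<in> K"
    using Cons by (intro subspace_add[OF K] tK foldr_t_in) auto
  then show ?case by simp
qed (simp add: subspace_0[OF K])

lemma site_sign_K: 
  assumes "1 \<le> k" "x \<in> T" shows "site_sign k x - x \<in> K"
proof -
  let ?x = "foldr t (rev [k..<l]) x"
  have x: "?x \<in> T" using assms by (intro foldr_t_in) auto
  have "(site_sign k x - z ?x) + (z ?x - ?x) + (?x - x) \<in> K"
    unfolding site_sign_def using assms x by (intro subspace_add[OF K] zK foldr_t_K z_in) auto
  then show ?thesis by simp
qed

lemma symmetrizer_K: "\<lbrakk>k \<le> l; x \<in> T\<rbrakk> \<Longrightarrow> symmetrizer k x - x \<in> K"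
proof (induction k)
  case (Suc k)
  let ?g = "symmetrizer k x"
  have g: "?g \<in> T" using Suc by (intro symmetrizer_in) auto
  have "sc (1 / of_nat (Suc k)) (\<Sum>j\<in>{1..k+1}. foldr t [j..<k+1] ?g - ?g) \<in> K"
    using Suc g by (intro subspace_scale subspace_sum K foldr_t_K) auto
  also have "sc (1 / of_nat (Suc k)) (\<Sum>j\<in>{1..k+1}. foldr t [j..<k+1] ?g - ?g) =
     symmetrizer (Suc k) x - ?g"
    by (simp add: sum_subtractf scale_right_diff_distrib sum_constant_scale del: upt_Suc of_nat_Suc)
  finally have "(symmetrizer (Suc k) x - ?g) + (?g - x) \<in> K"
    using Suc by (intro subspace_add K) auto
  then show ?case by (simp del: symmetrizer.simps)
qed (simp add: subspace_0[OF K])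

lemma foldr_sign_average_K: "\<lbrakk>set xs \<subseteq> {1..l}; x \<in> T\<rbrakk> \<Longrightarrow> foldr sign_average xs x - x \<in> K"
proof (induction xs)
  case (Cons k xs)
  let ?g = "foldr sign_average xs x"
  have g: "?g \<in> T" using Cons by (intro foldr_sign_average_in) auto
  have "sc (1/2) (site_sign k ?g - ?g) + (?g - x) \<in> K"
    using Cons g by (intro subspace_add subspace_scale K site_sign_K) auto
  moreover have "sc (1/2) (site_sign k ?g - ?g) = sign_average k ?g - ?g"
  proof -
    have "sc (1/2) ?g + sc (1/2) ?g = ?g"
      by (simp flip: scale_left_distrib)
    then have "sc (1/2) ?g - ?g = - sc (1/2) ?g" by (simp add: algebra_simps)
    then show ?thesis unfolding sign_average_def by (simp add: algebra_simps)
  qed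
  ultimately show ?case by simp
qed (simp add: subspace_0[OF K])

text \<open>Permutations are averaged first and signs second, since the sign average preserves the
  invariance already gained.\<close>

lemma ex_invariant_representative:
  assumes g: "g \<in> T"
  shows "\<exists>f\<in>T. (\<forall>i\<in>{1..<l}. t i f = f) \<and> z f = f \<and> f - g \<in> K"
proof (intro bexI conjI ballI)
  let ?h = "symmetrizer l g" and ?f = "foldr sign_average [1..<Suc l] (symmetrizer l g)"
  have h: "?h \<in> T" using g by (intro symmetrizer_in) auto
  show "?f \<in> T" using h by (intro foldr_sign_average_in) auto
  show "z ?f = ?f" using h by (rule z_foldr_sign_average_all)
  show "t i ?f = ?f" if "i \<in> {1..<l}" for i
    using that h g by (subst t_foldr_sign_average_all) (auto simp: t_symmetrizer)
  have "(?f - ?h) + (?h - g) \<in> K"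
    using h g by (intro subspace_add K foldr_sign_average_K symmetrizer_K) auto
  then show "?f - g \<in> K" by simp
qed

end

end

context hecke_tensor
begin

abbreviation K where "K \<equiv> Ksp sc s eps \<kappa> l e \<sigma> \<zeta>"

lemma e_sq: "(of_int e :: complex) * of_int e = 1"
  using e_pm by auto

lemma K_subspace: "is_subspace sT K"
  by (auto simp: Ksp_def is_subspace_def)

lemma Sg_K: "\<lbrakk>k \<in> {1..<l}; f \<in> T\<rbrakk> \<Longrightarrow> Sg k f - sT (of_int e) f \<in> K"
  and Zt_K: "f \<in> T \<Longrightarrow> Zt f - sT (of_int e) f \<in> K"
  by (auto simp: Ksp_def)

text \<open>Multiplying the operators by \<open>e\<close> makes the character trivial. The two sides
  of each Coxeter relation have lengths of the same parity, so the relations survive.\<close>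

lemma ex_invariant_mod_K:
  assumes "g \<in> T"
  shows "\<exists>f\<in>T. (\<forall>k\<in>{1..<l}. Sg k f = sT (of_int e) f) \<and> Zt f = sT (of_int e) f \<and> f - g \<in> K"
proof -
  let ?t = "\<lambda>k f. sT (of_int e) (Sg k f)" and ?z = "\<lambda>f. sT (of_int e) (Zt f)"
  interpret H: hyperoctahedral_action sT T l ?t ?z
  proof unfold_locales
    show "T.subspace T" using T_subspace by (simp add: T.is_subspace_iff)
    then show "sT (of_int e) (Sg i x) \<in> T" "sT (of_int e) (Zt x) \<in> T" for i x
      by (intro T.subspace_scale; simp)+
    show "1 \<le> l" by (rule l_pos)
    show "is_linear sT (?t i)" if "i \<in> {1..<l}" for i
      using lin_Sg[OF that] by (auto simp: is_linear_def algebra_simps)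
    show "is_linear sT ?z"
      using lin_Zt by (auto simp: is_linear_def algebra_simps)
    fix x assume x: "x \<in> T"
    show "?t i (?t i x) = x" if "i \<in> {1..<l}" for i
      using that x by (simp add: is_linear_scale[OF lin_Sg] Sg_Sg e_sq)
    show "?z (?z x) = x"
      using x by (simp add: is_linear_scale[OF lin_Zt] Zt_Zt e_sq)
    show "?t i (?t (i+1) (?t i x)) = ?t (i+1) (?t i (?t (i+1) x))" if "1 \<le> i" "i + 1 < l" for i
      using that Sg_braid[OF that, of x] by (simp add: is_linear_scale[OF lin_Sg])
    show "?t i (?t j x) = ?t j (?t i x)" if "1 \<le> i" "i + 1 < j" "j < l" for i j
      using that Sg_commute[OF that, of x] by (simp add: is_linear_scale[OF lin_Sg])
    show "?t i (?z x) = ?z (?t i x)" if "1 \<le> i" "i + 1 < l" for i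
      using that Sg_Zt[OF that, of x] by (simp add: is_linear_scale[OF lin_Sg] is_linear_scale[OF lin_Zt])
    show "?t (l-1) (?z (?t (l-1) (?z x))) = ?z (?t (l-1) (?z (?t (l-1) x)))" if "2 \<le> l"
      using that Sg_Zt_braid[OF that, of x]
      by (simp add: is_linear_scale[OF lin_Sg] is_linear_scale[OF lin_Zt])
  qed
  have K: "T.subspace K" using K_subspace by (simp add: T.is_subspace_iff)
  have "?t i x - x \<in> K" if "i \<in> {1..<l}" "x \<in> T" for i x
    using T.subspace_scale[OF K Sg_K[OF that], of "of_int e"] by (simp add: T.scale_right_diff_distrib e_sq)
  moreover have "?z x - x \<in> K" if "x \<in> T" for x
    using T.subspace_scale[OF K Zt_K[OF that], of "of_int e"] by (simp add: T.scale_right_diff_distrib e_sq)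
  ultimately obtain f where f: "f \<in> T" "\<And>i. i \<in> {1..<l} \<Longrightarrow> ?t i f = f" "?z f = f" "f - g \<in> K"
    using H.ex_invariant_representative[OF K _ _ assms] by blast
  have "Sg i f = sT (of_int e) f" if "i \<in> {1..<l}" for i
    using arg_cong[OF f(2)[OF that], of "sT (of_int e)"] by (simp add: e_sq)
  moreover have "Zt f = sT (of_int e) f"
    using arg_cong[OF f(3), of "sT (of_int e)"] by (simp add: e_sq)
  ultimately show ?thesis using f by blast
qed

end

section \<open>The degree filtration and words\<close>

lemma (in vector_space) scale_sgnop: "scale c (sgnop k x) = sgnop k (scale c x)"
  by (simp add: sgnop_def)

text \<open>A list of quadruples \<open>(c, a, i, j)\<close> encodes the word in the operators \<open>y\<^sub>c\<^sup>a E\<^sub>i\<^sub>j\<^sup>(\<^sup>c\<^sup>)\<close>.\<close>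
definition rename :: "(nat \<Rightarrow> nat) \<Rightarrow> (nat \<times> nat \<times> nat \<times> nat) list \<Rightarrow> (nat \<times> nat \<times> nat \<times> nat) list" where
  "rename \<tau> = map (\<lambda>(c, a, i, j). (\<tau> c, a, i, j))"

definition deg :: "(nat \<times> nat \<times> nat \<times> nat) list \<Rightarrow> nat" where
  "deg ws = (\<Sum>(c, a, i, j)\<leftarrow>ws. a)"

lemma deg_simps [simp]: "deg [] = 0" "deg ((c, a, i, j) # ws) = a + deg ws" "deg (us @ ws) = deg us + deg ws"
  by (simp_all add: deg_def)

lemma rename_simps [simp]: "rename \<tau> [] = []" "rename \<tau> ((c, a, i, j) # ws) = (\<tau> c, a, i, j) # rename \<tau> ws"
  by (simp_all add: rename_def)

lemma deg_rename [simp]: "deg (rename \<tau> ws) = deg ws"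
  by (simp add: deg_def rename_def case_prod_unfold o_def)

lemma rename_rename: "rename \<tau> (rename \<upsilon> ws) = rename (\<tau> \<circ> \<upsilon>) ws"
  by (simp add: rename_def case_prod_unfold o_def)

lemma rename_id: "(\<And>w. w \<in> set ws \<Longrightarrow> \<tau> (fst w) = fst w) \<Longrightarrow> rename \<tau> ws = ws"
  unfolding rename_def by (intro map_idI) auto

locale invariant_vector = hecke_tensor sc m n l s eps e th1 th2 \<sigma> \<zeta> y
  for sc :: "complex \<Rightarrow> 'm::ab_group_add \<Rightarrow> 'm" and m n l s eps e th1 th2 \<sigma> \<zeta> y +
  fixes f :: "nat list \<Rightarrow> 'm"
  assumes f_in_T: "f \<in> Tsp (m + n) l"
    and Sg_f: "k \<in> {1..<l} \<Longrightarrow> sigmaT s (m + n) l \<sigma> k f = scaleT sc (of_int e) f"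
    and Zt_f: "varsigmaT sc eps (m + n) l \<zeta> f = scaleT sc (of_int e) f"
begin

text \<open>Induction over the predicate below produces eta-long vectors, which these rules would
  rewrite pointwise.\<close>
declare plus_fun_apply [simp del] zero_fun_apply [simp del] minus_apply [simp del] uminus_apply [simp del]

text \<open>The index is a strict bound on the degree in the \<open>y\<close>'s, so that \<open>filt 0\<close> is trivial.\<close>
inductive filt :: "nat \<Rightarrow> (nat list \<Rightarrow> 'm) \<Rightarrow> bool" where
  zero: "filt k 0"
| base: "filt (Suc k) f"
| add: "filt k v \<Longrightarrow> filt k w \<Longrightarrow> filt k (v + w)"
| scale: "filt k v \<Longrightarrow> filt k (sT c v)"
| E: "filt k v \<Longrightarrow> c \<in> {1..l} \<Longrightarrow> i \<in> {1..\<kappa>} \<Longrightarrow> j \<in> {1..\<kappa>} \<Longrightarrow> filt k (E c i j v)"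
| Y: "filt k v \<Longrightarrow> c \<in> {1..l} \<Longrightarrow> filt (Suc k) (Y c v)"

lemmas filt_zero = filt.zero and filt_base = filt.base and filt_add = filt.add and filt_scale = filt.scale
  and filt_E = filt.E and filt_Y = filt.Y

lemma subspace_T: "T.subspace T"
  using T_subspace by (simp add: T.is_subspace_iff)

lemma filt_in_T: "filt k v \<Longrightarrow> v \<in> T"
  by (induction rule: filt.induct)
     (auto intro: T.subspace_0 T.subspace_add T.subspace_scale subspace_T f_in_T)

lemma filt_Suc: "filt k v \<Longrightarrow> filt (Suc k) v"
  by (induction rule: filt.induct) (auto intro: filt.intros)

lemma filt_mono: "k \<le> k' \<Longrightarrow> filt k v \<Longrightarrow> filt k' v"
  by (induction rule: dec_induct) (auto intro: filt_Suc)

lemma filt_minus: "filt k v \<Longrightarrow> filt k (- v)"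
  using filt_scale[of k v "- 1 :: complex"] by simp

lemma filt_sum: "(\<And>i. i \<in> A \<Longrightarrow> filt k (g i)) \<Longrightarrow> filt k (\<Sum>i\<in>A. g i)"
  by (induction A rule: infinite_finite_induct) (auto intro: filt_zero filt_add)

lemma filt_sgnop: "filt k v \<Longrightarrow> filt k (sgnop q v)"
  by (simp add: sgnop_def filt_minus)

section \<open>Stability of the filtration under the Weyl group\<close>

lemma filt_Flip: "\<lbrakk>filt k v; i \<in> {1..<l}\<rbrakk> \<Longrightarrow> filt k (Flip i v)"
  unfolding Flip_def by (intro filt_sum filt_scale filt_E) auto

lemma filt_Gop: "filt k v \<Longrightarrow> filt k (Gop v)"
  unfolding Gop_def using l_pos by (intro filt_sum filt_scale filt_E) auto

lemma transpose_site: "\<lbrakk>i \<in> {1..<l}; c \<in> {1..l}\<rbrakk> \<Longrightarrow> transpose i (i + 1) c \<in> {1..l}"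
  by (auto simp: transpose_def)

text \<open>\<open>Sg q\<close> is moved inwards until it reaches \<open>f\<close>, where it acts by
  a scalar. A correction from crossing a \<open>Y\<close> has one \<open>Y\<close> less.\<close>

lemma filt_Sg: "\<lbrakk>filt k v; q \<in> {1..<l}\<rbrakk> \<Longrightarrow> filt k (Sg q v)"
proof (induction rule: filt.induct)
  case (Y k v c)
  then have "filt (Suc k) (Y (transpose q (q + 1) c) (Sg q v) +
      sT (if c = q then th1 else if c = q + 1 then - th1 else 0) (Flip q v))"
    by (intro filt_add filt_Y filt_scale filt_Suc[OF filt_Flip] transpose_site) auto
  then show ?case by (simp only: Sg_Y[OF Y.prems Y.hyps(2)])
next
  case (E k v c i j)
  then have "filt k (E (transpose q (q + 1) c) i j (Sg q v))"
    by (intro filt_E transpose_site) auto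
  then show ?case by (simp only: Sg_E[OF E.prems E.hyps(2,4)])
qed (auto simp: is_linear_simps[OF lin_Sg] Sg_f intro: filt.intros)

lemma filt_Zt: "filt k v \<Longrightarrow> filt k (Zt v)"
proof (induction rule: filt.induct)
  case (Y k v c)
  then have "filt (Suc k) (sT (if c = l then -1 else 1) (Y c (Zt v)) + sT (if c = l then th2 else 0) (Gop v))"
    by (intro filt_add filt_Y filt_scale filt_Suc[OF filt_Gop]) auto
  then show ?case by (simp only: Zt_Y[OF Y.hyps(2)])
next
  case (E k v c i j)
  then have "filt k (sT (if c = l then of_int (eps i * eps j) else 1) (E c i j (Zt v)))"
    by (intro filt_E filt_scale) auto
  then show ?case by (simp only: Zt_E[OF E.hyps(2-4)])
qed (auto simp: is_linear_simps[OF lin_Zt] Zt_f intro: filt.intros)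

lemma filt_Ypow: "\<lbrakk>filt k v; c \<in> {1..l}\<rbrakk> \<Longrightarrow> filt (k + a) ((Y c ^^ a) v)"
  by (induction a) (auto intro: filt_Y)

lemma lin_Ypow: "c \<in> {1..l} \<Longrightarrow> is_linear sT (Y c ^^ a)"
  by (intro is_linear_funpow lin_Y)

text \<open>Both terms lie only in \<open>filt (Suc (k + a))\<close>. Their difference gains one
  step, because every correction has a flip in place of a \<open>Y\<close>.\<close>

lemma filt_Sg_Ypow:
  assumes v: "filt (Suc k) v" and q: "q \<in> {1..<l}" and c: "c \<in> {1..l}"
  shows "filt (k + a) (Sg q ((Y c ^^ a) v) - (Y (transpose q (q + 1) c) ^^ a) (Sg q v))"
proof (induction a)
  case (Suc a)
  let ?c = "transpose q (q + 1) c" and ?u = "(Y c ^^ a) v"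
  have c': "?c \<in> {1..l}" using transpose_site q c by blast
  have eq: "Sg q (Y c ?u) - Y ?c ((Y ?c ^^ a) (Sg q v)) = Y ?c (Sg q ?u - (Y ?c ^^ a) (Sg q v)) +
     sT (if c = q then th1 else if c = q + 1 then - th1 else 0) (Flip q ?u)"
    unfolding Sg_Y[OF q c] is_linear_diff[OF lin_Y[OF c']] by simp
  have "filt (Suc (k + a)) (Flip q ?u)"
    using filt_Flip[OF filt_Ypow[OF v c, of a] q] by simp
  with Suc c' have "filt (Suc (k + a)) (Sg q (Y c ?u) - Y ?c ((Y ?c ^^ a) (Sg q v)))"
    unfolding eq by (intro filt_add filt_Y filt_scale; simp)
  then show ?case by simp
qed (simp add: filt_zero)

text \<open>Each crossing of \<open>Y l\<close> gives a factor -1 and a correction in which that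
  \<open>Y\<close> is replaced by \<open>Gop\<close>.\<close>

lemma filt_Zt_Ypow:
  assumes v: "filt (Suc k) v" and c: "c \<in> {1..l}"
  shows "filt (k + a) (Zt ((Y c ^^ a) v) - sT (if c = l then (-1) ^ a else 1) ((Y c ^^ a) (Zt v)))"
proof (induction a)
  case (Suc a)
  let ?u = "(Y c ^^ a) v"
  have eq: "Zt (Y c ?u) - sT (if c = l then (-1) ^ Suc a else 1) (Y c ((Y c ^^ a) (Zt v))) =
     sT (if c = l then -1 else 1) (Y c (Zt ?u - sT (if c = l then (-1) ^ a else 1) ((Y c ^^ a) (Zt v)))) +
     sT (if c = l then th2 else 0) (Gop ?u)"
    unfolding Zt_Y[OF c] is_linear_simps[OF lin_Y[OF c]] by (simp add: T.scale_right_diff_distrib)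
  have "filt (Suc (k + a)) (Gop ?u)"
    using filt_Gop[OF filt_Ypow[OF v c, of a]] by simp
  with Suc c have "filt (Suc (k + a)) (Zt (Y c ?u) - sT (if c = l then (-1) ^ Suc a else 1) (Y c ((Y c ^^ a) (Zt v))))"
    unfolding eq by (intro filt_add filt_Y filt_scale; simp)
  then show ?case by simp
qed (simp add: filt_zero)

section \<open>Words applied to the invariant vector\<close>

fun letter :: "nat \<times> nat \<times> nat \<times> nat \<Rightarrow> (nat list \<Rightarrow> 'm) \<Rightarrow> nat list \<Rightarrow> 'm" where
  "letter (c, a, i, j) v = (Y c ^^ a) (E c i j v)"

definition wd :: "(nat \<times> nat \<times> nat \<times> nat) list \<Rightarrow> nat list \<Rightarrow> 'm" where
  "wd ws = foldr letter ws f"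

fun valid1 :: "nat \<times> nat \<times> nat \<times> nat \<Rightarrow> bool" where
  "valid1 (c, a, i, j) \<longleftrightarrow> c \<in> {1..l} \<and> i \<in> {1..\<kappa>} \<and> j \<in> {1..\<kappa>}"

abbreviation valid :: "(nat \<times> nat \<times> nat \<times> nat) list \<Rightarrow> bool" where
  "valid \<equiv> list_all valid1"

lemma wd_simps [simp]: "wd [] = f" "wd (w # ws) = letter w (wd ws)"
  by (simp_all add: wd_def)

lemma lin_letter: "valid1 w \<Longrightarrow> is_linear sT (letter w)"
proof (cases w)
  case (fields c a i j)
  assume "valid1 w"
  then have "is_linear sT (Y c ^^ a)" "is_linear sT (E c i j)"
    using lin_Ypow lin_E by (auto simp: fields)
  then show ?thesis by (simp add: is_linear_def fields)
qed

lemma filt_letter: "\<lbrakk>filt k v; valid1 (c, a, i, j)\<rbrakk> \<Longrightarrow> filt (k + a) (letter (c, a, i, j) v)"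
  by (simp add: filt_Ypow filt_E)

lemma filt_wd: "valid ws \<Longrightarrow> filt (Suc (deg ws)) (wd ws)"
proof (induction ws)
  case (Cons w ws)
  obtain c a i j where w: "w = (c, a, i, j)" by (metis surj_pair)
  show ?case using Cons filt_letter[of "Suc (deg ws)" "wd ws" c a i j] by (simp add: w add.commute)
qed (simp add: filt_base)

lemma valid_rename:
  "\<lbrakk>valid ws; \<And>c. c \<in> {1..l} \<Longrightarrow> \<tau> c \<in> {1..l}\<rbrakk> \<Longrightarrow> valid (rename \<tau> ws)"
  unfolding list_all_iff rename_def by fastforce

lemma Sg_letter:
  assumes v: "filt (Suc k) v" and q: "q \<in> {1..<l}" and w: "valid1 (c, a, i, j)"
  shows "filt (k + a) (Sg q (letter (c, a, i, j) v) - letter (transpose q (q + 1) c, a, i, j) (Sg q v))"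
  using filt_Sg_Ypow[OF filt_E[OF v] q, of c i j c a] w Sg_E[OF q, of c j i v] by simp

text \<open>Crossing a letter renames its site up to lower degree; the scalar \<open>e\<close>
  appears when \<open>f\<close> is reached.\<close>

lemma Sg_wd:
  assumes q: "q \<in> {1..<l}"
  shows "valid ws \<Longrightarrow> filt (deg ws) (Sg q (wd ws) - sT (of_int e) (wd (rename (transpose q (q + 1)) ws)))"
proof (induction ws)
  case Nil
  then show ?case by (simp add: Sg_f[OF q] filt_zero)
next
  case (Cons w ws)
  let ?\<tau> = "transpose q (q + 1)"
  obtain c a i j where w: "w = (c, a, i, j)" by (metis surj_pair)
  have v: "valid1 (c, a, i, j)" "valid ws" using Cons by (auto simp: w)
  then have v': "valid1 (?\<tau> c, a, i, j)" using transpose_site[OF q, of c] by simp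
  let ?d = "Sg q (wd ws) - sT (of_int e) (wd (rename ?\<tau> ws))"
  have "filt (deg ws + a) ((Sg q (letter (c, a, i, j) (wd ws)) - letter (?\<tau> c, a, i, j) (Sg q (wd ws)))
     + letter (?\<tau> c, a, i, j) ?d)"
    using v v' Cons by (intro filt_add Sg_letter filt_wd filt_letter q) auto
  then show ?case
    unfolding is_linear_diff[OF lin_letter[OF v']] is_linear_scale[OF lin_letter[OF v']]
    by (simp add: w add.commute del: letter.simps)
qed

lemma Zt_letter:
  assumes v: "filt (Suc k) v" and w: "valid1 (c, a, i, j)"
  shows "filt (k + a) (Zt (letter (c, a, i, j) v) -
    sT (if c = l then (-1) ^ a * of_int (eps i * eps j) else 1) (letter (c, a, i, j) (Zt v)))"
proof -
  have w': "c \<in> {1..l}" "i \<in> {1..\<kappa>}" "j \<in> {1..\<kappa>}" using w by auto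
  show ?thesis
    using filt_Zt_Ypow[OF filt_E[OF v w'] w'(1), of a, unfolded Zt_E[OF w']]
    by (simp add: is_linear_scale[OF lin_Ypow[OF w'(1)]] split: if_splits)
qed

lemma Zt_wd_off:
  "\<lbrakk>valid ws; l \<notin> fst ` set ws\<rbrakk> \<Longrightarrow> filt (deg ws) (Zt (wd ws) - sT (of_int e) (wd ws))"
proof (induction ws)
  case Nil
  then show ?case by (simp add: Zt_f filt_zero)
next
  case (Cons w ws)
  obtain c a i j where w: "w = (c, a, i, j)" by (metis surj_pair)
  have v: "valid1 (c, a, i, j)" "valid ws" and c: "c \<noteq> l" using Cons by (auto simp: w)
  have "filt (deg ws + a) ((Zt (letter (c, a, i, j) (wd ws)) -
     sT (if c = l then (-1) ^ a * of_int (eps i * eps j) else 1) (letter (c, a, i, j) (Zt (wd ws))))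
     + letter (c, a, i, j) (Zt (wd ws) - sT (of_int e) (wd ws)))"
    using v Cons by (intro filt_add Zt_letter filt_wd filt_letter) auto
  then show ?case by (simp add: w c add.commute is_linear_diff[OF lin_letter[OF v(1)]]
        is_linear_scale[OF lin_letter[OF v(1)]] del: letter.simps)
qed

text \<open>Only the head sits at site \<open>l\<close>: its \<open>a\<close> factors
  \<open>Y l\<close> give \<open>(-1) ^ a\<close>, its matrix unit gives
  \<open>eps i * eps j\<close>, and the rest contributes \<open>e\<close> alone.\<close>

lemma Zt_wd_head:
  assumes "valid ((l, a, i, j) # ws)" "l \<notin> fst ` set ws"
  shows "filt (deg ws + a) (Zt (wd ((l, a, i, j) # ws)) -
    sT ((-1) ^ a * of_int (eps i * eps j) * of_int e) (wd ((l, a, i, j) # ws)))"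
proof -
  let ?L = "letter (l, a, i, j)" and ?\<mu> = "(-1) ^ a * of_int (eps i * eps j) :: complex"
  have v: "valid1 (l, a, i, j)" "valid ws" using assms by auto
  have "filt (deg ws + a) ((Zt (?L (wd ws)) - sT (if l = l then ?\<mu> else 1) (?L (Zt (wd ws))))
     + sT ?\<mu> (?L (Zt (wd ws) - sT (of_int e) (wd ws))))"
    using v assms by (intro filt_add filt_scale Zt_letter filt_wd filt_letter Zt_wd_off) auto
  then show ?thesis by (simp add: is_linear_diff[OF lin_letter[OF v(1)]]
        is_linear_scale[OF lin_letter[OF v(1)]] T.scale_right_diff_distrib del: letter.simps)
qed

text \<open>The \<open>Y\<close> operators commute with each other and with matrix units, so the
  sign is that of the matrix units alone.\<close>

lemma letter_commute:
  assumes v: "valid1 (c, a, i, j)" "valid1 (c', a', i', j')" and ne: "c \<noteq> c'"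
  shows "letter (c, a, i, j) (letter (c', a', i', j') v) =
    sgnop ((par s i + par s j) * (par s i' + par s j')) (letter (c', a', i', j') (letter (c, a, i, j) v))"
proof -
  have YE: "E k p q ((Y d ^^ b) u) = (Y d ^^ b) (E k p q u)" if "d \<in> {1..l}" "q \<in> {1..\<kappa>}" for k p q d b u
    by (induction b) (auto simp: Y_E[OF that, symmetric])
  have YY1: "Y d ((Y d' ^^ b) u) = (Y d' ^^ b) (Y d u)" if "d \<in> {1..l}" "d' \<in> {1..l}" for d d' b u
    by (induction b) (auto simp: Y_Y[OF that])
  have YY: "(Y d ^^ b) ((Y d' ^^ b') u) = (Y d' ^^ b') ((Y d ^^ b) u)"
    if "d \<in> {1..l}" "d' \<in> {1..l}" for d d' b b' u
    by (induction b) (auto simp: YY1[OF that])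
  have w: "c \<in> {1..l}" "c' \<in> {1..l}" "j \<in> {1..\<kappa>}" "j' \<in> {1..\<kappa>}" using v by auto
  have "letter (c, a, i, j) (letter (c', a', i', j') v) = (Y c ^^ a) ((Y c' ^^ a') (E c i j (E c' i' j' v)))"
    using w by (simp add: YE)
  also have "\<dots> = (Y c' ^^ a') ((Y c ^^ a) (E c i j (E c' i' j' v)))"
    by (rule YY[OF w(1,2)])
  also have "E c i j (E c' i' j' v) = sgnop ((par s i + par s j) * (par s i' + par s j')) (E c' i' j' (E c i j v))"
    using w ne by (intro Eop_commute) auto
  also have "(Y c' ^^ a') ((Y c ^^ a) \<dots>) = sgnop ((par s i + par s j) * (par s i' + par s j'))
     ((Y c' ^^ a') ((Y c ^^ a) (E c' i' j' (E c i j v))))"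
    by (simp only: is_linear_sgnop[OF lin_Ypow[OF w(1)]] is_linear_sgnop[OF lin_Ypow[OF w(2)]])
  also have "(Y c ^^ a) (E c' i' j' (E c i j v)) = E c' i' j' ((Y c ^^ a) (E c i j v))"
    using YE[OF w(1,4)] by simp
  finally show ?thesis by simp
qed

lemma letter_merge:
  assumes "valid1 (c, a, i, j)"
  shows "letter (c, a, i, j) (letter (c, a', i', j') v) =
    (if j = i' then letter (c, a + a', i, j') v else 0)"
proof -
  have w: "c \<in> {1..l}" "j \<in> {1..\<kappa>}" using assms by auto
  have YE: "E c i j ((Y c ^^ b) u) = (Y c ^^ b) (E c i j u)" for b u
    by (induction b) (auto simp: Y_E[OF w, symmetric])
  show ?thesis
    using w Eop_Eop[of c l j \<kappa> s i i' j' v] is_linear_zero[OF lin_Ypow[OF w(1)]]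
    by (simp add: YE funpow_add)
qed

text \<open>The head is carried past letters at other sites to the next letter at \<open>c\<close>,
  where the matrix units multiply. Degree is kept and one letter is lost. The sign stays
  unspecified, as only membership in a subspace is at stake.\<close>

lemma wd_merge:
  assumes "valid ((c, a, i, j) # us @ (c, a', i', j') # vs)" "c \<notin> fst ` set us"
  shows "\<exists>k. wd ((c, a, i, j) # us @ (c, a', i', j') # vs) =
    sgnop k (if j = i' then wd (us @ (c, a + a', i, j') # vs) else 0)"
  using assms
proof (induction us)
  case Nil
  then have "valid1 (c, a, i, j)" by simp
  from letter_merge[OF this] show ?case
    by (intro exI[of _ 0]) (simp add: sgnop_def del: letter.simps)
next
  case (Cons u us)
  obtain d b p q where u: "u = (d, b, p, q)" by (metis surj_pair)
  have v: "valid1 (c, a, i, j)" "valid1 (d, b, p, q)" "c \<noteq> d" using Cons by (auto simp: u)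
  obtain k where k: "wd ((c, a, i, j) # us @ (c, a', i', j') # vs) =
    sgnop k (if j = i' then wd (us @ (c, a + a', i, j') # vs) else 0)"
    using Cons by auto
  let ?k = "(par s i + par s j) * (par s p + par s q)"
  have "wd ((c, a, i, j) # (u # us) @ (c, a', i', j') # vs) =
    sgnop ?k (letter u (wd ((c, a, i, j) # us @ (c, a', i', j') # vs)))"
    by (simp add: u letter_commute[OF v] del: letter.simps)
  also have "\<dots> = sgnop (?k + k) (if j = i' then wd ((u # us) @ (c, a + a', i, j') # vs) else 0)"
    unfolding k using is_linear_simps[OF lin_letter[OF v(2)]] by (simp add: u sgnop_sgnop del: letter.simps)
  finally show ?case by blast
qed

text \<open>Translates the filtration into words, so that an induction over words controls every
  error term of lower degree.\<close>

lemma filt_span: "filt k v \<Longrightarrow> v \<in> T.span {wd ws |ws. valid ws \<and> deg ws < k}"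
proof (induction rule: filt.induct)
  case (base k)
  have "f = wd []" by simp
  then show ?case by (intro T.span_base CollectI exI[of _ "[]"]) auto
next
  case (E k v c i j)
  show ?case using E.IH
  proof (induction rule: T.span_induct)
    case base
    show ?case unfolding T.subspace_def 
      by (auto simp: is_linear_simps[OF lin_E] intro: T.span_add T.span_scale T.span_zero)
  next
    case (step x)
    then obtain ws where "x = wd ws" "valid ws" "deg ws < k" by auto
    then show ?case using E by (intro T.span_base CollectI exI[of _ "(c, 0, i, j) # ws"]) auto
  qed
next
  case (Y k v c)
  show ?case using Y.IH
  proof (induction rule: T.span_induct)
    case base
    show ?case unfolding T.subspace_def
      by (auto simp: is_linear_simps[OF lin_Y[OF Y.hyps(2)]] intro: T.span_add T.span_scale T.span_zero)
  next
    case (step x)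
    then obtain ws where ws: "x = wd ws" "valid ws" "deg ws < k" by auto
    have "x \<in> T" using ws filt_wd filt_in_T by blast
    \<comment> \<open>A bare \<open>Y c\<close> is not a letter, so the identity of \<open>T\<close>
      is inserted as the sum of the diagonal matrix units at site \<open>c\<close>.\<close>
    then have "Y c x = (\<Sum>i\<in>{1..\<kappa>}. Y c (E c i i x))"
      using Eop_sum_diag[of c l x \<kappa> s] Y.hyps(2) by (simp flip: is_linear_sum[OF lin_Y[OF Y.hyps(2)]])
    also have "\<dots> \<in> T.span {wd ws |ws. valid ws \<and> deg ws < Suc k}"
    proof (intro T.span_sum T.span_base CollectI)
      fix i assume "i \<in> {1..\<kappa>}"
      then show "\<exists>ws. Y c (E c i i x) = wd ws \<and> valid ws \<and> deg ws < Suc k"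
        using ws Y.hyps(2) by (intro exI[of _ "(c, 1, i, i) # ws"]) auto
    qed
    finally show ?case .
  qed
qed (auto intro: T.span_zero T.span_add T.span_scale)

end

section \<open>Leading terms of the generators\<close>

lemma sgnop_diff: "sgnop k (x - y) = sgnop k x - sgnop k (y :: 'a::ab_group_add)"
  by (simp add: sgnop_def)

context invariant_vector
begin

text \<open>The operator \<open>X (Suc r) i j\<close> has degree at most \<open>r\<close> in the \<open>y\<close>'s, with leading part \<open>L r i j\<close>.\<close>
definition lead :: "'m ser \<Rightarrow> (nat \<Rightarrow> complex) \<Rightarrow> 'm ser \<Rightarrow> bool" where
  "lead X g L \<longleftrightarrow> (\<forall>i\<in>{1..\<kappa>}. \<forall>j\<in>{1..\<kappa>}.
     (\<forall>v\<in>T. X 0 i j v = (if i = j then sT (g i) v else 0)) \<and> (\<forall>r. X r i j 0 = 0) \<and>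
     (\<forall>r k v. filt (Suc k) v \<longrightarrow> filt (k + Suc r) (L r i j v) \<and> filt (k + r) (X (Suc r) i j v - L r i j v)))"

lemma leadD:
  assumes "lead X g L" "i \<in> {1..\<kappa>}" "j \<in> {1..\<kappa>}"
  shows "v \<in> T \<Longrightarrow> X 0 i j v = (if i = j then sT (g i) v else 0)" "X r i j 0 = 0"
    "filt (Suc k) v \<Longrightarrow> filt (k + Suc r) (L r i j v)"
    "filt (Suc k) v \<Longrightarrow> filt (k + r) (X (Suc r) i j v - L r i j v)"
    "filt (Suc k) v \<Longrightarrow> filt (k + Suc r) (X (Suc r) i j v)"
proof -
  show 1: "v \<in> T \<Longrightarrow> X 0 i j v = (if i = j then sT (g i) v else 0)" "X r i j 0 = 0"
    "filt (Suc k) v \<Longrightarrow> filt (k + Suc r) (L r i j v)"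
    "filt (Suc k) v \<Longrightarrow> filt (k + r) (X (Suc r) i j v - L r i j v)"
    using assms unfolding lead_def by blast+
  show "filt (k + Suc r) (X (Suc r) i j v)" if "filt (Suc k) v"
    using filt_add[OF 1(3)[OF that] filt_mono[OF _ 1(4)[OF that], of "k + Suc r"]] by simp
qed

lemma lead_one: "lead one_ser (\<lambda>_. 1) (\<lambda>r i j v. 0)"
  by (auto simp: lead_def one_ser_def filt_zero zero_fun_apply)

lemma mmul_apply: "mmul \<kappa> s X Z r i j v = (\<Sum>p\<le>r. \<Sum>k\<in>{1..\<kappa>}.
    sgnop ((par s i + par s k) * (par s k + par s j)) (X p i k (Z (r - p) k j v)))"
  by (simp add: mmul_def sum_fun_apply sgnop_apply)

text \<open>In the coefficient of index \<open>Suc r\<close>, the two terms using a constant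
  coefficient carry the leading part. Every other term takes a positive power of \<open>1/u\<close>
  from both factors and so loses a degree.\<close>

lemma lead_mmul:
  assumes X: "lead X g L" and Z: "lead Z h M"
  shows "lead (mmul \<kappa> s X Z) (\<lambda>i. g i * h i) (\<lambda>r i j v. L r i j (sT (h j) v) + sT (g i) (M r i j v))"
  unfolding lead_def
proof (intro ballI conjI allI impI)
  fix i j assume ij: "i \<in> {1..\<kappa>}" "j \<in> {1..\<kappa>}"
  show "mmul \<kappa> s X Z 0 i j v = (if i = j then sT (g i * h i) v else 0)" if v: "v \<in> T" for v
  proof -
    have "mmul \<kappa> s X Z 0 i j v = (\<Sum>k\<in>{1..\<kappa>}. if k = j then if i = j then sT (g i * h i) v else 0 else 0)"
      unfolding mmul_apply atMost_0
    proof (simp only: sum.insert finite.emptyI empty_iff not_False_eq_True sum.empty add_0_right, intro sum.cong refl)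
      fix k assume k: "k \<in> {1..\<kappa>}"
      have "sT (h j) v \<in> T" using v by (intro T.subspace_scale[OF subspace_T])
      then show "sgnop ((par s i + par s k) * (par s k + par s j)) (X 0 i k (Z (0 - 0) k j v)) =
        (if k = j then if i = j then sT (g i * h i) v else 0 else 0)"
        using leadD(1)[OF X ij(1) k] leadD(1)[OF Z k ij(2) v] leadD(2)[OF X ij(1) k]
        by (auto simp: sgnop_zero sgnop_def)
    qed
    then show ?thesis using ij by simp
  qed
  show "mmul \<kappa> s X Z r i j 0 = 0" for r
    unfolding mmul_apply using ij leadD(2)[OF X ij(1)] leadD(2)[OF Z _ ij(2)]
    by (simp add: sgnop_zero)
  fix r k v assume v: "filt (Suc k) v"
  have vT: "v \<in> T" using v by (rule filt_in_T)
  show "filt (k + Suc r) (L r i j (sT (h j) v) + sT (g i) (M r i j v))"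
    using leadD(3)[OF X ij filt_scale[OF v]] leadD(3)[OF Z ij v] by (intro filt_add filt_scale)
  \<comment> \<open>The end terms \<open>F 0\<close> and \<open>F (Suc r)\<close> are split off.
    Constant coefficients are diagonal, which collapses the sum over \<open>q\<close> there and
    makes the Koszul sign trivial.\<close>
  define F where "F p = (\<Sum>q\<in>{1..\<kappa>}. sgnop ((par s i + par s q) * (par s q + par s j))
    (X p i q (Z (Suc r - p) q j v)))" for p
  have "(\<Sum>p\<le>Suc r. F p) = F 0 + (\<Sum>p\<le>r. F (Suc p))" by (rule sum.atMost_Suc_shift)
  also have "(\<Sum>p\<le>r. F (Suc p)) = (\<Sum>p<r. F (Suc p)) + F (Suc r)"
    by (simp flip: lessThan_Suc_atMost)
  finally have split_sum: "mmul \<kappa> s X Z (Suc r) i j v = F 0 + (\<Sum>p<r. F (Suc p)) + F (Suc r)"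
    by (simp add: mmul_apply F_def add.assoc)
  have F0: "F 0 = sT (g i) (Z (Suc r) i j v)"
  proof -
    have "F 0 = (\<Sum>q\<in>{1..\<kappa>}. if q = i then sT (g i) (Z (Suc r) i j v) else 0)"
      unfolding F_def
    proof (intro sum.cong refl)
      fix q assume q: "q \<in> {1..\<kappa>}"
      have "Z (Suc r) q j v \<in> T" using leadD(5)[OF Z q ij(2) v] by (rule filt_in_T)
      then show "sgnop ((par s i + par s q) * (par s q + par s j)) (X 0 i q (Z (Suc r - 0) q j v)) =
        (if q = i then sT (g i) (Z (Suc r) i j v) else 0)"
        using leadD(1)[OF X ij(1) q] by (auto simp: sgnop_zero sgnop_def)
    qed
    then show ?thesis using ij by simp
  qed
  have FS: "F (Suc r) = X (Suc r) i j (sT (h j) v)"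
  proof -
    have "F (Suc r) = (\<Sum>q\<in>{1..\<kappa>}. if q = j then X (Suc r) i j (sT (h j) v) else 0)"
      unfolding F_def
    proof (intro sum.cong refl)
      fix q assume q: "q \<in> {1..\<kappa>}"
      show "sgnop ((par s i + par s q) * (par s q + par s j)) (X (Suc r) i q (Z (Suc r - Suc r) q j v)) =
        (if q = j then X (Suc r) i j (sT (h j) v) else 0)"
        using leadD(1)[OF Z q ij(2) vT] leadD(2)[OF X ij(1) q] by (auto simp: sgnop_zero sgnop_def)
    qed
    then show ?thesis using ij by simp
  qed
  \<comment> \<open>\<open>X (Suc p)\<close> adds degree at most \<open>p\<close> and
    \<open>Z (Suc r - Suc p)\<close> at most \<open>r - p - 1\<close>, in total less than
    \<open>r\<close>.\<close>
  have Fm: "filt (k + r) (F (Suc p))" if p: "p < r" for p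
    unfolding F_def
  proof (intro filt_sum filt_sgnop)
    fix q assume q: "q \<in> {1..\<kappa>}"
    have "filt (k + Suc (r - Suc p)) (Z (Suc (r - Suc p)) q j v)"
      by (rule leadD(5)[OF Z q ij(2) v])
    then have "filt (Suc (k + (r - Suc p))) (Z (Suc r - Suc p) q j v)" 
      using p by (simp add: Suc_diff_Suc)
    from leadD(5)[OF X ij(1) q this, of p] show "filt (k + r) (X (Suc p) i q (Z (Suc r - Suc p) q j v))"
      using p by simp
  qed
  have "filt (k + r) (sT (g i) (Z (Suc r) i j v - M r i j v) + (\<Sum>p<r. F (Suc p)) +
      (X (Suc r) i j (sT (h j) v) - L r i j (sT (h j) v)))"
    by (intro filt_add filt_scale filt_sum Fm leadD(4)[OF X ij] leadD(4)[OF Z ij] v) simp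
  then show "filt (k + r) (mmul \<kappa> s X Z (Suc r) i j v - (L r i j (sT (h j) v) + sT (g i) (M r i j v)))"
    unfolding split_sum F0 FS by (simp add: algebra_simps)
qed

text \<open>Factors with constant coefficient 1 just add their leading parts; the constant
  coefficient \<open>h\<close> of the tail enters as a scalar.\<close>

lemma lead_foldr_mmul:
  assumes "\<And>k. k \<in> set ks \<Longrightarrow> lead (A k) (\<lambda>_. 1) (LA k)" and "lead Z h M"
  shows "lead (foldr (mmul \<kappa> s) (map A ks) Z) h
    (\<lambda>r i j v. (\<Sum>k\<leftarrow>ks. LA k r i j (sT (h j) v)) + M r i j v)"
  using assms(1)
proof (induction ks)
  case Nil
  then show ?case using assms(2) by simp
next
  case (Cons k ks)
  have "lead (mmul \<kappa> s (A k) (foldr (mmul \<kappa> s) (map A ks) Z)) (\<lambda>i. 1 * h i)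
     (\<lambda>r i j v. LA k r i j (sT (h j) v) + sT 1 ((\<Sum>k\<leftarrow>ks. LA k r i j (sT (h j) v)) + M r i j v))"
    by (intro lead_mmul Cons) auto
  then show ?case by (simp add: add.assoc)
qed

text \<open>Choosing the scalar \<open>c\<close> in a factor of the power gives up one
  \<open>Y\<close>, so only the pure power of \<open>Y q\<close> has full degree.\<close>

lemma cpow_lead:
  assumes v: "filt (Suc k) v" and q: "q \<in> {1..l}"
  shows "filt (k + r) (cpow sc c (\<lambda>f. sT x (Y q f)) r v - sT (x ^ r) ((Y q ^^ r) v))"
proof (induction r)
  case (Suc r)
  let ?P = "cpow sc c (\<lambda>f. sT x (Y q f)) r v" and ?Q = "sT (x ^ r) ((Y q ^^ r) v)"
  have "filt (Suc k + r) (?P - ?Q + ?Q)"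
    using v q Suc by (intro filt_add filt_scale filt_Ypow filt_mono[OF _ Suc]) auto
  then have P: "filt (Suc (k + r)) ?P" by simp
  have "cpow sc c (\<lambda>f. sT x (Y q f)) (Suc r) v - sT (x ^ Suc r) ((Y q ^^ Suc r) v)
     = sT c ?P + sT x (Y q (?P - ?Q))"
    by (simp add: cpow_def is_linear_simps[OF lin_Y[OF q]] T.scale_right_diff_distrib)
  moreover have "filt (Suc (k + r)) (sT c ?P + sT x (Y q (?P - ?Q)))"
    using P Suc q by (intro filt_add filt_scale filt_Y)
  ultimately show ?case by simp
qed (simp add: cpow_def filt_zero)

text \<open>The common shape of \<open>Tser\<close> (with \<open>x = \<chi>\<close>) and
  \<open>Sser\<close> (with \<open>x = - \<chi>\<close>).\<close>

lemma lead_resolvent: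
  assumes q: "q \<in> {1..l}"
  shows "lead (\<lambda>r i j. if r = 0 then (if i = j then id else 0)
      else cpow sc c (\<lambda>f. sT x (Y q f)) (r - 1) \<circ> Qop s \<kappa> l q i j) (\<lambda>_. 1)
    (\<lambda>r i j v. sT (x ^ r) ((Y q ^^ r) (Qop s \<kappa> l q i j v)))"
proof -
  have z: "cpow sc c (\<lambda>f. sT x (Y q f)) r 0 = 0" for r
    by (induction r) (auto simp: cpow_def is_linear_zero[OF lin_Y[OF q]])
  have Q: "Qop s \<kappa> l q i j v = sgnop (par s i * par s j + par s i + par s j) (E q i j v)" for i j v
    by (simp add: Qop_def sgnop_apply)
  have fQ: "filt k (Qop s \<kappa> l q i j v)" if "filt k v" "i \<in> {1..\<kappa>}" "j \<in> {1..\<kappa>}" for k i j v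
    unfolding Q using that q by (intro filt_sgnop filt_E)
  show ?thesis
    unfolding lead_def
  proof (intro ballI conjI allI impI, goal_cases)
    case 2
    then show ?case
      by (auto simp: z Q sgnop_zero is_linear_zero[OF lin_E] zero_fun_apply)
  next
    case (3 i j r k v)
    then show ?case using filt_Ypow[OF fQ[OF 3(3,1,2)] q, of r] by (intro filt_scale) simp
  next
    case (4 i j r k v)
    then show ?case using cpow_lead[OF fQ[OF 4(3,1,2)] q, of r c x] by simp
  qed (auto simp: zero_fun_apply)
qed

lemma lead_G:
  "lead (Gser sc eps \<gamma>) (\<lambda>i. of_int (eps i)) (\<lambda>r i j v. if i = j \<and> r = 0 then sT \<gamma> v else 0)"
  by (auto simp: lead_def Gser_def filt_zero zero_fun_apply intro: filt_scale)

text \<open>The factors \<open>Tser\<close> stand left of \<open>G\<close> and give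
  \<open>\<chi> ^ r\<close> times \<open>eps j\<close>; the factors \<open>Sser\<close> stand right
  of it and give \<open>(- \<chi>) ^ r\<close> times \<open>eps i\<close>. The term of
  \<open>Gser\<close> with \<open>\<gamma>\<close> contributes for \<open>r = 0\<close>
  only.\<close>

lemma bgen_lead:
  assumes ij: "i \<in> {1..\<kappa>}" "j \<in> {1..\<kappa>}" and v: "filt (Suc k) v"
  shows "filt (k + r) (bgen sc s eps m n l y \<gamma> \<chi> (Suc r) i j v -
     sgnop (par s i * par s j + par s j)
       (sgnop (par s i * par s j + par s i + par s j)
         (sT (\<chi> ^ r * (of_int (eps j) + (-1) ^ r * of_int (eps i))) (\<Sum>c\<in>{1..l}. letter (c, r, i, j) v))
       + (if i = j \<and> r = 0 then sT \<gamma> v else 0)))"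
proof -
  let ?LA = "\<lambda>x q r i j v. sT (x ^ r) ((Y q ^^ r) (Qop s \<kappa> l q i j v))"
  have T: "lead (Tser sc s m n l y \<chi> q) (\<lambda>_. 1) (?LA \<chi> q)" if "q \<in> set [1..<Suc l]" for q
    using that unfolding Tser_def by (intro lead_resolvent) auto
  have S: "lead (Sser sc s m n l y \<chi> q) (\<lambda>_. 1) (?LA (- \<chi>) q)" if "q \<in> set (rev [1..<Suc l])" for q
    using that unfolding Sser_def by (intro lead_resolvent) auto
  let ?P = "mprod \<kappa> s (map (Tser sc s m n l y \<chi>) [1..<Suc l] @ [Gser sc eps \<gamma>] @
                     map (Sser sc s m n l y \<chi>) (rev [1..<Suc l]))"
  let ?L = "\<lambda>r i j v. (\<Sum>q\<leftarrow>[1..<Suc l]. ?LA \<chi> q r i j (sT (of_int (eps j) * 1) v)) +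
       ((if i = j \<and> r = 0 then sT \<gamma> (sT 1 v) else 0) +
        sT (of_int (eps i)) ((\<Sum>q\<leftarrow>rev [1..<Suc l]. ?LA (- \<chi>) q r i j (sT 1 v)) + 0))"
  have "lead ?P (\<lambda>i. of_int (eps i) * 1) ?L"
    unfolding mprod_def foldr_append foldr.simps o_apply id_apply
    by (intro lead_foldr_mmul T S lead_mmul[OF lead_G] lead_one)
  from leadD(4)[OF this ij v]
  have 1: "filt (k + r) (?P (Suc r) i j v - ?L r i j v)" .
  let ?k = "par s i * par s j + par s i + par s j"
  have LA: "?LA x q r i j (sT a v) = sgnop ?k (sT (x ^ r * a) (letter (q, r, i, j) v))"
    if "q \<in> {1..l}" for x q a
    using lin_Ypow[OF that] by (simp add: Qop_def sgnop_apply is_linear_simps[OF lin_E]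
       is_linear_simps[OF lin_Ypow[OF that]] T.scale_sgnop)
  have sgn_sum: "sgnop ?k (sT a (\<Sum>c\<in>{1..l}. g c)) = (\<Sum>c\<in>{1..l}. sgnop ?k (sT a (g c)))" for a g
    by (simp add: sgnop_def T.scale_sum_right sum_negf)
  have sumT: "(\<Sum>q\<leftarrow>[1..<Suc l]. ?LA \<chi> q r i j (sT (of_int (eps j) * 1) v)) =
      sgnop ?k (sT (\<chi> ^ r * of_int (eps j)) (\<Sum>c\<in>{1..l}. letter (c, r, i, j) v))"
    unfolding sgn_sum interv_sum_list_conv_sum_set_nat
    by (intro sum.cong) (auto simp: LA simp del: letter.simps)
  have sumS: "(\<Sum>q\<leftarrow>rev [1..<Suc l]. ?LA (- \<chi>) q r i j (sT 1 v)) =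
      sgnop ?k (sT ((-\<chi>) ^ r) (\<Sum>c\<in>{1..l}. letter (c, r, i, j) v))"
    unfolding sgn_sum rev_map[symmetric] sum_list_rev interv_sum_list_conv_sum_set_nat
    by (intro sum.cong) (auto simp: LA simp del: letter.simps T.scale_one)
  have "?L r i j v = sgnop ?k (sT (\<chi> ^ r * (of_int (eps j) + (-1) ^ r * of_int (eps i)))
      (\<Sum>c\<in>{1..l}. letter (c, r, i, j) v)) + (if i = j \<and> r = 0 then sT \<gamma> v else 0)"
  proof -
    have c: "\<chi> ^ r * (of_int (eps j) + (-1) ^ r * of_int (eps i)) =
        \<chi> ^ r * of_int (eps j) + of_int (eps i) * (-\<chi>) ^ r"
      by (simp add: power_minus[of \<chi>] distrib_left)
    show ?thesis
      unfolding sumT sumS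
      unfolding c T.scale_left_distrib sgnop_add T.scale_sgnop T.scale_scale T.scale_one add_0_right
      by (simp only: add_ac)
  qed
  with 1 have "filt (k + r) (?P (Suc r) i j v - (sgnop ?k (sT (\<chi> ^ r * (of_int (eps j) + (-1) ^ r * of_int (eps i)))
      (\<Sum>c\<in>{1..l}. letter (c, r, i, j) v)) + (if i = j \<and> r = 0 then sT \<gamma> v else 0)))"
    by (simp only:)
  from filt_sgnop[OF this, of "par s i * par s j + par s j"] show ?thesis
    unfolding sgnop_diff bgen_def sgnop_apply[of _ "?P (Suc r) i j" v] .
qed

end

section \<open>Irreducibility\<close>

context invariant_vector
begin

section \<open>From one nonzero vector to the whole tensor space\<close>

definition pure_tensor :: "nat list \<Rightarrow> 'm \<Rightarrow> nat list \<Rightarrow> 'm" where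
  "pure_tensor b x = (\<lambda>a. if a = b then x else 0)"

definition reach :: "(nat list \<Rightarrow> 'm) set" where
  "reach = {v. \<exists>k. filt k v}"

lemma reach_intros:
  shows reach_f: "f \<in> reach" and reach_0: "0 \<in> reach"
    and reach_add: "\<lbrakk>v \<in> reach; w \<in> reach\<rbrakk> \<Longrightarrow> v + w \<in> reach"
    and reach_scale: "v \<in> reach \<Longrightarrow> sT c v \<in> reach"
    and reach_E: "\<lbrakk>v \<in> reach; k \<in> {1..l}; i \<in> {1..\<kappa>}; j \<in> {1..\<kappa>}\<rbrakk> \<Longrightarrow> E k i j v \<in> reach"
    and reach_Y: "\<lbrakk>v \<in> reach; k \<in> {1..l}\<rbrakk> \<Longrightarrow> Y k v \<in> reach"
    and reach_Sg: "\<lbrakk>v \<in> reach; k \<in> {1..<l}\<rbrakk> \<Longrightarrow> Sg k v \<in> reach"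
    and reach_Zt: "v \<in> reach \<Longrightarrow> Zt v \<in> reach"
    and reach_Flip: "\<lbrakk>v \<in> reach; k \<in> {1..<l}\<rbrakk> \<Longrightarrow> Flip k v \<in> reach"
    and reach_Gop: "v \<in> reach \<Longrightarrow> Gop v \<in> reach"
proof -
  show "v + w \<in> reach" if "v \<in> reach" "w \<in> reach"
  proof -
    obtain k k' where "filt k v" "filt k' w" using \<open>v \<in> reach\<close> \<open>w \<in> reach\<close> by (auto simp: reach_def)
    then have "filt (max k k') (v + w)"
      by (intro filt_add filt_mono[OF max.cobounded1] filt_mono[OF max.cobounded2])
    then show ?thesis by (auto simp: reach_def)
  qed
qed (auto simp: reach_def intro: filt_base filt_zero filt_scale filt_E filt_Y filt_Sg filt_Zt filt_Flip filt_Gop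
    simp del: atLeastAtMost_iff atLeastLessThan_iff One_nat_def)

lemma reach_sgnop: "sgnop q v \<in> reach \<Longrightarrow> v \<in> reach"
  using reach_scale[of "- v" "-1"] by (auto simp: sgnop_def split: if_splits)

lemma E_pure:
  assumes c: "c \<in> dr_idx \<kappa> l" "c ! (k - 1) = j" and k: "k \<in> {1..l}" and i: "i \<in> {1..\<kappa>}"
  shows "E k i j (pure_tensor c x) = sgnop ((par s i + par s j) * parity_sum s c (k - 1)) (pure_tensor (c[k - 1 := i]) x)"
proof
  fix a
  have len: "length c = l" using c by (intro length_dr_idx)
  have ci: "c[k - 1 := i] \<in> dr_idx \<kappa> l" using c i by (intro update_dr_idx)
  have eq: "a ! (k - 1) = i \<and> a[k - 1 := j] = c \<longleftrightarrow> a = c[k - 1 := i]" if "length a = l"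
  proof
    assume "a ! (k - 1) = i \<and> a[k - 1 := j] = c"
    then show "a = c[k - 1 := i]" by (metis list_update_id list_update_overwrite)
  next
    assume "a = c[k - 1 := i]"
    then show "a ! (k - 1) = i \<and> a[k - 1 := j] = c"
      using k len c(2) by (auto simp: list_update_same_conv)
  qed
  show "E k i j (pure_tensor c x) a = sgnop ((par s i + par s j) * parity_sum s c (k - 1)) (pure_tensor (c[k - 1 := i]) x) a"
  proof (cases "a = c[k - 1 := i]")
    case True
    then have "a[k - 1 := j] = c" "a ! (k - 1) = i" using eq[of] len by auto
    then show ?thesis using True ci by (simp add: Eop_app sgnop_apply pure_tensor_def parity_sum_update_ge)
  next
    case False
    then show ?thesis using eq length_dr_idx[of a]
      by (auto simp: Eop_app sgnop_apply pure_tensor_def sgnop_zero)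
  qed
qed

text \<open>The entries are replaced one at a time from the left; a suitable matrix unit maps one
  simple tensor to the next up to sign.\<close>

lemma pure_reach_move:
  assumes x: "pure_tensor b x \<in> reach" and b: "b \<in> dr_idx \<kappa> l" and b': "b' \<in> dr_idx \<kappa> l"
  shows "pure_tensor b' x \<in> reach"
proof -
  have len: "length b = l" "length b' = l" using b b' length_dr_idx by auto
  have "q \<le> l \<Longrightarrow> take q b' @ drop q b \<in> dr_idx \<kappa> l \<and> pure_tensor (take q b' @ drop q b) x \<in> reach" for q
  proof (induction q)
    case 0
    then show ?case using x b by simp
  next
    case (Suc q)
    let ?c = "take q b' @ drop q b"
    have c: "?c \<in> dr_idx \<kappa> l" "pure_tensor ?c x \<in> reach" using Suc by auto
    have upd: "?c[q := b' ! q] = take (Suc q) b' @ drop (Suc q) b"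
      using Suc.prems len
      by (simp add: list_update_append take_Suc_conv_app_nth Cons_nth_drop_Suc[symmetric])
    have q: "b ! q \<in> {1..\<kappa>}" "b' ! q \<in> {1..\<kappa>}" "?c ! q = b ! q"
      using nth_dr_idx[OF b] nth_dr_idx[OF b'] Suc.prems len by (auto simp: nth_append)
    have "E (Suc q) (b' ! q) (b ! q) (pure_tensor ?c x) \<in> reach"
      using c q Suc.prems by (intro reach_E) auto
    then have "pure_tensor (?c[q := b' ! q]) x \<in> reach"
      using E_pure[OF c(1), of "Suc q" "b ! q" "b' ! q" x] q Suc.prems by (auto dest: reach_sgnop)
    moreover have "?c[q := b' ! q] \<in> dr_idx \<kappa> l" using c q by (intro update_dr_idx)
    ultimately show ?case by (simp add: upd)
  qed
  from this[of l] show ?thesis using len by simp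
qed

text \<open>Diagonal matrix units, applied at the sites in turn, cut \<open>f\<close> down to its
  component at \<open>a\<close>.\<close>

lemma pure_f_reach:
  assumes a: "a \<in> dr_idx \<kappa> l"
  shows "pure_tensor a (f a) \<in> reach"
proof -
  have "q \<le> l \<Longrightarrow> (\<lambda>b. if \<forall>p<q. b ! p = a ! p then f b else 0) \<in> reach" for q
  proof (induction q)
    case 0
    then show ?case by (simp add: reach_f)
  next
    case (Suc q)
    let ?g = "\<lambda>b. if \<forall>p<q. b ! p = a ! p then f b else 0"
    have aq: "a ! q \<in> {1..\<kappa>}" using nth_dr_idx[OF a] Suc.prems by auto
    have "E (Suc q) (a ! q) (a ! q) ?g \<in> reach"
      using Suc aq by (intro reach_E) auto
    also have "E (Suc q) (a ! q) (a ! q) ?g = (\<lambda>b. if \<forall>p<Suc q. b ! p = a ! p then f b else 0)"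
      using f_in_T
      by (auto simp: fun_eq_iff Eop_app sgnop_def Tsp_def less_Suc_eq list_update_same_conv)
         (metis list_update_id)+
    finally show ?case .
  qed
  from this[of l] have "(\<lambda>b. if \<forall>p<l. b ! p = a ! p then f b else 0) \<in> reach" by simp
  also have "(\<lambda>b. if \<forall>p<l. b ! p = a ! p then f b else 0) = pure_tensor a (f a)"
    using f_in_T length_dr_idx[OF a]
    by (auto simp: fun_eq_iff pure_tensor_def Tsp_def intro: nth_equalityI dest: length_dr_idx)
       (metis length_dr_idx nth_equalityI)
  finally show ?thesis .
qed

text \<open>The second flip undoes the exchange of factors inside \<open>Sg k\<close>, and the two
  signs cancel, so only the action on the module remains.\<close>

lemma pure_\<sigma>:
  assumes "k \<in> {1..<l}" "b \<in> dr_idx \<kappa> l"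
  shows "pure_tensor b (\<sigma> k x) = Flip k (Sg k (pure_tensor b x))"
proof
  fix a
  have ws: "1 \<le> k" "k < l" using assms by auto
  show "pure_tensor b (\<sigma> k x) a = Flip k (Sg k (pure_tensor b x)) a"
    using assms ws length_dr_idx[of a]
    by (auto simp: Flip_app sigmaT_app swp_dr_idx swp_swp nth_swp pure_tensor_def sgnop_sgnop sgnop_zero
        is_linear_zero[OF lin_\<sigma>] simp del: One_nat_def atLeastLessThan_iff) (auto simp: sgnop_def)
qed

lemma pure_\<zeta>:
  assumes "b \<in> dr_idx \<kappa> l"
  shows "pure_tensor b (\<zeta> x) = Gop (Zt (pure_tensor b x))"
proof
  fix a
  have "a \<in> dr_idx \<kappa> l \<Longrightarrow> a ! (l - 1) \<in> {1..\<kappa>}" using nth_dr_idx[of a \<kappa> l] l_pos by auto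
  then show "pure_tensor b (\<zeta> x) a = Gop (Zt (pure_tensor b x)) a"
    using assms eps_sq[of "a ! (l - 1)"]
    by (auto simp: Gop_app varsigmaT_def pure_tensor_def is_linear_zero[OF lin_\<zeta>] simp del: atLeastAtMost_iff)
qed

lemma pure_y: "\<lbrakk>k \<in> {1..l}; b \<in> dr_idx \<kappa> l\<rbrakk> \<Longrightarrow> pure_tensor b (y k x) = Y k (pure_tensor b x)"
  by (auto simp: yT_def pure_tensor_def fun_eq_iff is_linear_zero[OF lin_y])

lemma finite_dr_idx: "finite (dr_idx \<kappa> l)"
proof -
  have "dr_idx \<kappa> l = {a. set a \<subseteq> {1..\<kappa>} \<and> length a = l}" by (auto simp: dr_idx_def)
  then show ?thesis by (simp add: finite_lists_length_eq)
qed

text \<open>The vectors all of whose simple tensors are reachable form a submodule. It contains a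
  nonzero coefficient of \<open>f\<close>, hence is everything by irreducibility, and simple tensors
  span \<open>T\<close>.\<close>

lemma reach_eq_T:
  assumes irr: "irreducible_Hmod sc l th1 th2 \<sigma> \<zeta> y" and f: "f \<noteq> 0"
  shows "T \<subseteq> reach"
proof
  obtain a where a: "f a \<noteq> 0" using f by (auto simp: fun_eq_iff zero_fun_apply)
  then have a_idx: "a \<in> dr_idx \<kappa> l" using f_in_T by (auto simp: Tsp_def)
  define S where "S = {x. \<forall>b\<in>dr_idx \<kappa> l. pure_tensor b x \<in> reach}"
  have fa: "f a \<in> S"
    unfolding S_def using pure_reach_move[OF pure_f_reach[OF a_idx] a_idx] by blast
  have pure_0: "pure_tensor b 0 = 0" for b by (auto simp: pure_tensor_def fun_eq_iff zero_fun_apply)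
  have pure_add: "pure_tensor b (x + y) = pure_tensor b x + pure_tensor b y" for b x y
    by (auto simp: pure_tensor_def fun_eq_iff plus_fun_apply)
  have pure_scale: "pure_tensor b (sc c x) = sT c (pure_tensor b x)" for b c x
    by (auto simp: pure_tensor_def fun_eq_iff sT_app)
  have "is_subspace sc S"
    unfolding is_subspace_def S_def
    by (auto simp: pure_0 pure_add pure_scale intro: reach_0 reach_add reach_scale)
  moreover have "\<sigma> i ` S \<subseteq> S" if "i \<in> {1..<l}" for i
    unfolding S_def using pure_\<sigma>[OF that] that by (auto intro!: reach_Flip reach_Sg)
  moreover have "\<zeta> ` S \<subseteq> S"
    unfolding S_def using pure_\<zeta> by (auto intro!: reach_Gop reach_Zt)
  moreover have "y k ` S \<subseteq> S" if "k \<in> {1..l}" for k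
    unfolding S_def using pure_y[OF that] that by (auto intro!: reach_Y)
  ultimately have "S = {0} \<or> S = UNIV"
    using irr unfolding irreducible_Hmod_def by blast
  with fa a have S: "S = UNIV" by auto
  fix g assume g: "g \<in> T"
  have "g = (\<Sum>b\<in>dr_idx \<kappa> l. pure_tensor b (g b))"
    using g finite_dr_idx by (auto simp: fun_eq_iff sum_fun_apply pure_tensor_def Tsp_def)
  moreover have "(\<Sum>b\<in>B. pure_tensor b (g b)) \<in> reach" if "B \<subseteq> dr_idx \<kappa> l" for B
    using finite_subset[OF that finite_dr_idx] that S
    by (induction B rule: finite_induct) (auto simp: S_def intro: reach_0 reach_add)
  ultimately show "g \<in> reach" by (metis order_refl)
qed

end

section \<open>Words in a stable subspace that contains the invariant vector\<close>

locale stable_subspace = invariant_vector sc m n l s eps e th1 th2 \<sigma> \<zeta> y f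
  for sc :: "complex \<Rightarrow> 'm::ab_group_add \<Rightarrow> 'm" and m n l s eps e th1 th2 \<sigma> \<zeta> y f +
  fixes \<gamma> \<chi> :: complex and W :: "(nat list \<Rightarrow> 'm) set"
  assumes \<chi>: "\<chi> \<noteq> 0"
    and W_subspace': "is_subspace (scaleT sc) W"
    and K_W: "Ksp sc s eps (m + n) l e \<sigma> \<zeta> \<subseteq> W"
    and bgen_W: "\<lbrakk>1 \<le> r; i \<in> {1..m+n}; j \<in> {1..m+n}; v \<in> W\<rbrakk> \<Longrightarrow>
      bgen sc s eps m n l y \<gamma> \<chi> r i j v \<in> W"
    and f_W: "f \<in> W"
begin

lemma W_subspace: "T.subspace W"
  using W_subspace' by (simp add: T.is_subspace_iff)

lemmas W_add = T.subspace_add[OF W_subspace]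
  and W_diff = T.subspace_diff[OF W_subspace]
  and W_scale = T.subspace_scale[OF W_subspace]
  and W_sum = T.subspace_sum[OF W_subspace]
  and W_0 = T.subspace_0[OF W_subspace]

lemma W_diff_cancel: "\<lbrakk>v - w \<in> W; v \<in> W\<rbrakk> \<Longrightarrow> w \<in> W"
  using W_diff[of v "v - w"] by simp

lemma W_scale_cancel: "\<lbrakk>sT c v \<in> W; c \<noteq> 0\<rbrakk> \<Longrightarrow> v \<in> W"
  using W_scale[of "sT c v" "inverse c"] by simp

lemma W_sgnop: "sgnop k v \<in> W \<longleftrightarrow> v \<in> W"
  using W_scale[of v "-1"] W_scale[of "- v" "-1"] by (auto simp: sgnop_def)

lemma wd_in_T: "valid ws \<Longrightarrow> wd ws \<in> T"
  using filt_wd filt_in_T by blast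

section \<open>Words of degree \<open>d\<close> modulo terms of lower degree\<close>

context
  fixes d
  assumes lower: "\<And>v. filt d v \<Longrightarrow> v \<in> W"
begin

text \<open>\<open>Sg q (wd ws)\<close> is congruent to \<open>e\<close> times the renamed word by
  \<open>Sg_wd\<close>, and to \<open>e\<close> times the word itself modulo
  \<open>K\<close>.\<close>

lemma wd_rename_Suc:
  assumes q: "q \<in> {1..<l}" and ws: "valid ws" "deg ws = d"
  shows "wd ws - wd (rename (transpose q (q + 1)) ws) \<in> W"
proof -
  let ?w = "wd (rename (transpose q (q + 1)) ws)"
  have "Sg q (wd ws) - sT (of_int e) ?w \<in> W"
    using Sg_wd[OF q ws(1)] ws(2) by (intro lower) simp
  moreover have "Sg q (wd ws) - sT (of_int e) (wd ws) \<in> W"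
    using Sg_K[OF q wd_in_T[OF ws(1)]] K_W by blast
  ultimately have "(Sg q (wd ws) - sT (of_int e) ?w) - (Sg q (wd ws) - sT (of_int e) (wd ws)) \<in> W"
    by (rule W_diff)
  then have "sT (of_int e) (wd ws - ?w) \<in> W" by (simp add: T.scale_right_diff_distrib)
  then show ?thesis by (rule W_scale_cancel) (use e_pm in auto)
qed

text \<open>Induction on the distance of the two sites, conjugating with an adjacent
  transposition.\<close>

lemma wd_rename_transpose:
  assumes "c \<in> {1..l}" "c' \<in> {1..l}" "valid ws" "deg ws = d"
  shows "wd ws - wd (rename (transpose c c') ws) \<in> W"
proof -
  have *: "\<forall>c ws. 1 \<le> c \<longrightarrow> c + k \<le> l \<longrightarrow> valid ws \<longrightarrow> deg ws = d \<longrightarrow>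
     wd ws - wd (rename (transpose c (c + k)) ws) \<in> W" for k
  proof (induction k)
    case 0
    then show ?case by (simp add: rename_id W_0)
  next
    case (Suc k)
    show ?case
    proof (intro allI impI)
      fix c ws assume c: "1 \<le> c" "c + Suc k \<le> l" and ws: "valid ws" "deg ws = d"
      show "wd ws - wd (rename (transpose c (c + Suc k)) ws) \<in> W"
      \<comment> \<open>For \<open>k = 0\<close> the inner transposition is the identity and its
        conjugate would be too, so adjacent sites are treated directly.\<close>
      proof (cases "k = 0")
        case True
        then show ?thesis using wd_rename_Suc[of c ws] c ws by simp
      next
        case False
        let ?t = "transpose c (c + 1)" and ?t' = "transpose (c + 1) (c + 1 + k)"
        have q: "c \<in> {1..<l}" using c by auto
        have site: "\<And>p. p \<in> {1..l} \<Longrightarrow> ?t p \<in> {1..l}" "\<And>p. p \<in> {1..l} \<Longrightarrow> ?t' p \<in> {1..l}"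
          using c by (auto simp: transpose_def)
        let ?w1 = "rename ?t ws" and ?w2 = "rename ?t' (rename ?t ws)"
        have v: "valid ?w1" "valid ?w2" by (intro valid_rename ws site; assumption)+
        have "wd ws - wd ?w1 \<in> W" using q ws by (rule wd_rename_Suc)
        moreover have "wd ?w1 - wd ?w2 \<in> W" using v ws c by (intro Suc.IH[rule_format]) auto
        moreover have "wd ?w2 - wd (rename ?t ?w2) \<in> W" using q v ws by (intro wd_rename_Suc) auto
        ultimately have "(wd ws - wd ?w1) + (wd ?w1 - wd ?w2) + (wd ?w2 - wd (rename ?t ?w2)) \<in> W"
          by (intro W_add)
        moreover have "?t \<circ> (?t' \<circ> ?t) = transpose c (c + Suc k)"
          using False by (auto simp: fun_eq_iff transpose_def)
        ultimately show ?thesis by (simp add: rename_rename)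
      qed
    qed
  qed
  show ?thesis
  proof (cases "c \<le> c'")
    case True
    then show ?thesis using *[of "c' - c"] assms by auto
  next
    case False
    then show ?thesis using *[of "c - c'"] assms by (auto simp: transpose_commute[of c c'])
  qed
qed

text \<open>Conjugation by a sign change shows that such a word is congruent to its negative.\<close>
lemma wd_odd:
  assumes ws: "valid ((c, a, i, j) # ws)" "c \<notin> fst ` set ws" "deg ((c, a, i, j) # ws) = d"
    and odd: "(-1) ^ a * (of_int (eps i * eps j) :: complex) = -1"
  shows "wd ((c, a, i, j) # ws) \<in> W"
proof -
  \<comment> \<open>The site is renamed to \<open>l\<close>, because \<open>Zt\<close> changes the
    sign at the last site.\<close>
  let ?t = "transpose c l" and ?ws = "(c, a, i, j) # ws"
  let ?us = "rename ?t ws"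
  let ?x = "wd ((l, a, i, j) # ?us)"
  have c: "c \<in> {1..l}" using ws by auto
  have r: "rename ?t ?ws = (l, a, i, j) # ?us" by simp
  have v: "valid ((l, a, i, j) # ?us)"
    unfolding r[symmetric] using c ws by (intro valid_rename) (auto simp: transpose_def)
  have us: "l \<notin> fst ` set ?us"
    using ws(2) unfolding rename_def by (force simp: transpose_def split: if_splits)
  have "Zt ?x - sT ((-1) ^ a * of_int (eps i * eps j) * of_int e) ?x \<in> W"
    using Zt_wd_head[OF v us] ws by (intro lower) (simp add: add.commute)
  moreover have "Zt ?x - sT (of_int e) ?x \<in> W"
    using Zt_K[OF wd_in_T[OF v]] K_W by blast
  ultimately have "(Zt ?x - sT ((-1) ^ a * of_int (eps i * eps j) * of_int e) ?x) -
     (Zt ?x - sT (of_int e) ?x) \<in> W" by (rule W_diff)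
  moreover have "(Zt ?x - sT ((-1) ^ a * of_int (eps i * eps j) * of_int e) ?x) -
     (Zt ?x - sT (of_int e) ?x) = sT (2 * of_int e) ?x"
    unfolding odd by (simp flip: T.scale_left_distrib)
  ultimately have "sT (2 * of_int e) ?x \<in> W" by simp
  then have "?x \<in> W" by (rule W_scale_cancel) (use e_pm in auto)
  moreover have "wd ?ws - ?x \<in> W"
    using wd_rename_transpose[OF c, of l ?ws] l_pos ws unfolding r by auto
  ultimately have "(wd ?ws - ?x) + ?x \<in> W" by (intro W_add)
  then show ?thesis by simp
qed

end

text \<open>Degree precedes length in the measure: error terms have lower degree but possibly more
  letters, while merging keeps the degree and drops a letter.\<close>

lemma wd_in_W: "valid ws \<Longrightarrow> wd ws \<in> W"
proof (induction ws rule: wf_induct_rule[OF wf_measures, of "[deg, length]"])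
  case (1 ws)
  have IH: "wd us \<in> W" if "valid us" "deg us < deg ws \<or> deg us = deg ws \<and> length us < length ws" for us
    using that 1(1) by auto
  have lower: "v \<in> W" if "filt (deg ws) v" for v
  proof -
    have "T.span {wd us |us. valid us \<and> deg us < deg ws} \<subseteq> W"
      using IH by (intro T.span_minimal W_subspace) auto
    then show ?thesis using filt_span[OF that] by blast
  qed
  show ?case
  proof (cases ws)
    case Nil
    then show ?thesis by (simp add: f_W)
  next
    case (Cons w us)
    obtain c a i j where w: "w = (c, a, i, j)" by (metis surj_pair)
    have v: "valid1 (c, a, i, j)" "valid us" and ws: "ws = (c, a, i, j) # us"
      using 1(2) by (auto simp: Cons w)
    have ij: "i \<in> {1..\<kappa>}" "j \<in> {1..\<kappa>}" using v by auto
    \<comment> \<open>Stated for every site occurring in \<open>us\<close>, since the sum over all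
      sites produced by a generator also meets these.\<close>
    have repeated: "wd ((c', a, i, j) # us) \<in> W" if c': "c' \<in> fst ` set us" "c' \<in> {1..l}" for c'
    proof -
      obtain xs u ys where "us = xs @ u # ys" "fst u = c'" and xs: "c' \<notin> fst ` set xs"
        using split_list_first_prop[of us "\<lambda>u. fst u = c'"] c' by fastforce
      then obtain a' i' j' where us: "us = xs @ (c', a', i', j') # ys" by (metis prod.collapse)
      have val: "valid ((c', a, i, j) # xs @ (c', a', i', j') # ys)" using v c' by (simp add: us)
      obtain k where k: "wd ((c', a, i, j) # us) = sgnop k (if j = i' then wd (xs @ (c', a + a', i, j') # ys) else 0)"
        using wd_merge[OF val xs] by (auto simp: us)
      have "wd (xs @ (c', a + a', i, j') # ys) \<in> W"
        using val by (intro IH) (auto simp: ws us)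
      then show ?thesis unfolding k by (simp add: W_sgnop W_0)
    qed
    have "((-1) ^ a * (of_int (eps i * eps j) :: complex) = 1) \<or> ((-1) ^ a * (of_int (eps i * eps j) :: complex) = -1)"
      using eps_pm[OF ij(1)] eps_pm[OF ij(2)] by (cases "even a") auto
    then consider "c \<in> fst ` set us"
      | "c \<notin> fst ` set us" "(-1) ^ a * (of_int (eps i * eps j) :: complex) = -1"
      | "c \<notin> fst ` set us" "(-1) ^ a * (of_int (eps i * eps j) :: complex) = 1" by blast
    then show ?thesis
    proof cases
      case 1
      then show ?thesis using repeated[of c] v by (simp add: ws)
    next
      case 2
      then show ?thesis using wd_odd[OF lower, where c = c and a = a and i = i and j = j and ws = us] 1(2) by (simp add: ws)
    next
      case 3
      have us: "wd us \<in> W" using v by (intro IH) (auto simp: ws)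
      let ?co = "\<chi> ^ a * (of_int (eps j) + (-1) ^ a * of_int (eps i))"
      let ?sum = "\<Sum>c'\<in>{1..l}. letter (c', a, i, j) (wd us)"
      let ?g = "if i = j \<and> a = 0 then sT \<gamma> (wd us) else 0"
      let ?k = "par s i * par s j + par s j" and ?k' = "par s i * par s j + par s i + par s j"
      \<comment> \<open>Since \<open>eps j\<close> squares to 1, the case assumption becomes
        \<open>(-1) ^ a * eps i = eps j\<close>, and so \<open>?co\<close> equals
        \<open>2 * \<chi> ^ a * eps j\<close>.\<close>
      have "(-1) ^ a * of_int (eps i) = (-1) ^ a * of_int (eps i) * (of_int (eps j) * of_int (eps j) :: complex)"
        using eps_sq[OF ij(2)] by simp
      also have "\<dots> = (-1) ^ a * of_int (eps i * eps j) * of_int (eps j)"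
        by (simp only: of_int_mult mult.assoc)
      also have "\<dots> = of_int (eps j)" unfolding 3(2) by simp
      finally have "(-1) ^ a * of_int (eps i) = (of_int (eps j) :: complex)" .
      then have co: "?co \<noteq> 0" using \<chi> eps_pm[OF ij(2)] by auto
      have "bgen sc s eps m n l y \<gamma> \<chi> (Suc a) i j (wd us) - sgnop ?k (sgnop ?k' (sT ?co ?sum) + ?g) \<in> W"
        \<comment> \<open>The error lies in \<open>filt (deg us + a)\<close>, which is
          \<open>filt (deg ws)\<close>.\<close>
        using bgen_lead[OF ij filt_wd[OF v(2)], where r = a and \<gamma> = \<gamma> and \<chi> = \<chi>] by (intro lower) (simp add: ws add.commute)
      moreover have "bgen sc s eps m n l y \<gamma> \<chi> (Suc a) i j (wd us) \<in> W"
        using us ij by (intro bgen_W) auto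
      ultimately have "sgnop ?k (sgnop ?k' (sT ?co ?sum) + ?g) \<in> W"
        by (rule W_diff_cancel)
      then have "sgnop ?k' (sT ?co ?sum) + ?g \<in> W" by (simp only: W_sgnop)
      moreover have "?g \<in> W" using us by (simp add: W_scale W_0)
      ultimately have "(sgnop ?k' (sT ?co ?sum) + ?g) - ?g \<in> W" by (rule W_diff)
      then have sum_W: "?sum \<in> W" using co by (auto simp: W_sgnop simp del: letter.simps dest: W_scale_cancel)
      \<comment> \<open>At a site absent from \<open>us\<close>, renaming \<open>c\<close> leaves
        \<open>us\<close> alone, so that summand is congruent to \<open>wd ws\<close>. The other
        summands are covered by \<open>repeated\<close>.\<close>
      let ?free = "{c' \<in> {1..l}. c' \<notin> fst ` set us}"
      have cong: "wd ws - wd ((c', a, i, j) # us) \<in> W" if c': "c' \<in> ?free" for c'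
      proof -
        have "rename (transpose c c') us = us"
          using c' 3(1) by (intro rename_id) (auto simp: transpose_def image_iff)
        then show ?thesis
          using wd_rename_transpose[OF lower, where c = c and c' = c' and ws = ws] c' v 1(2) by (simp add: ws del: letter.simps)
      qed
      \<comment> \<open>All summands but the copies of \<open>wd ws\<close> cancel, which leaves
        \<open>card ?free\<close> times \<open>wd ws\<close>.\<close>
      have "(\<Sum>c'\<in>?free. wd ws - wd ((c', a, i, j) # us)) +
         (?sum - (\<Sum>c'\<in>{1..l} - ?free. wd ((c', a, i, j) # us))) \<in> W"
      proof (intro W_add W_diff)
        show "(\<Sum>c'\<in>?free. wd ws - wd ((c', a, i, j) # us)) \<in> W"
          by (intro W_sum cong)
        show "(\<Sum>c'\<in>{1..l} - ?free. wd ((c', a, i, j) # us)) \<in> W"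
          by (intro W_sum repeated) auto
      qed (rule sum_W)
      moreover have "?sum = (\<Sum>c'\<in>?free. wd ((c', a, i, j) # us)) +
          (\<Sum>c'\<in>{1..l} - ?free. wd ((c', a, i, j) # us))"
        using sum.subset_diff[of ?free "{1..l}" "\<lambda>c'. wd ((c', a, i, j) # us)"]
        by (simp add: add.commute subset_iff del: letter.simps)
      ultimately have "(\<Sum>c'\<in>?free. wd ws) \<in> W"
        by (simp add: sum_subtractf del: letter.simps)
      then have "sT (of_nat (card ?free)) (wd ws) \<in> W" by (simp add: T.sum_constant_scale)
      \<comment> \<open>The site \<open>c\<close> itself is free, so the multiplicity is
        nonzero.\<close>
      moreover have "finite ?free" "c \<in> ?free" using v(1) 3(1) by simp_all
      then have "card ?free \<noteq> 0" by (metis card_0_eq empty_iff)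
      then have "(of_nat (card ?free) :: complex) \<noteq> 0" by (simp only: of_nat_eq_0_iff not_False_eq_True)
      ultimately show ?thesis by (rule W_scale_cancel)
    qed
  qed
qed

lemma reach_W: "reach \<subseteq> W"
proof
  fix v assume "v \<in> reach"
  then obtain k where k: "filt k v" by (auto simp: reach_def)
  have "T.span {wd us |us. valid us \<and> deg us < k} \<subseteq> W"
    using wd_in_W by (intro T.span_minimal W_subspace) auto
  then show "v \<in> W" using filt_span[OF k] by blast
qed

end

theorem theorem7p12:
  fixes m n l :: nat and s eps :: "nat \<Rightarrow> int" and e :: int
    and th1 th2 \<gamma> \<chi> :: complex
    and sc :: "complex \<Rightarrow> 'm::ab_group_add \<Rightarrow> 'm"
    and \<sigma> :: "nat \<Rightarrow> 'm \<Rightarrow> 'm" and \<zeta> :: "'m \<Rightarrow> 'm" and y :: "nat \<Rightarrow> 'm \<Rightarrow> 'm"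
  assumes "\<forall>i\<in>{1..m+n}. s i = 1 \<or> s i = -1"
    and "card {i\<in>{1..m+n}. s i = 1} = m"
    and "\<forall>i\<in>{1..m+n}. eps i = 1 \<or> eps i = -1"
    and "1 \<le> l"
    and "th1 \<noteq> 0" and "th2 \<noteq> 0"
    and "e = 1 \<or> e = -1"
    and "th2 = th1 * (2 * \<gamma> + of_int (varpi1 (m+n) s eps))"
    and "th1 * \<chi> = of_int e"
    and "irreducible_Hmod sc l th1 th2 \<sigma> \<zeta> y"
  shows "drinfeld_zero_or_irreducible sc s eps m n l e \<gamma> \<chi> \<sigma> \<zeta> y"
proof -
  have Hmod: "is_Hmod sc l th1 th2 \<sigma> \<zeta> y"
    using assms(10) by (simp add: irreducible_Hmod_def)
  have "vector_space sc" using Hmod by (simp add: is_Hmod_def)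
  then interpret vector_space sc .
  interpret hecke_tensor sc m n l s eps e th1 th2 \<sigma> \<zeta> y
    by unfold_locales (use assms Hmod in auto)
  show ?thesis
    unfolding drinfeld_zero_or_irreducible_def
  proof (intro allI impI, elim conjE)
    fix W assume W: "is_subspace (scaleT sc) W" "Ksp sc s eps (m+n) l e \<sigma> \<zeta> \<subseteq> W" "W \<subseteq> Tsp (m+n) l"
      and stable: "\<forall>r\<ge>1. \<forall>i\<in>{1..m+n}. \<forall>j\<in>{1..m+n}. \<forall>f\<in>W. bgen sc s eps m n l y \<gamma> \<chi> r i j f \<in> W"
    show "W = Ksp sc s eps (m+n) l e \<sigma> \<zeta> \<or> W = Tsp (m+n) l"
    proof (cases "W = Ksp sc s eps (m+n) l e \<sigma> \<zeta>")
      case False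
      then obtain g where g: "g \<in> W" "g \<notin> Ksp sc s eps (m+n) l e \<sigma> \<zeta>" using W by blast
      then obtain f where f: "f \<in> T" "\<And>k. k \<in> {1..<l} \<Longrightarrow> Sg k f = sT (of_int e) f"
          "Zt f = sT (of_int e) f" "f - g \<in> K"
        using ex_invariant_mod_K W by blast
      have KS: "T.subspace K" and WS: "T.subspace W"
        using K_subspace W(1) by (simp_all add: T.is_subspace_iff)
      have "(f - g) + g \<in> W" using W g f WS by (intro T.subspace_add) auto
      then have fW: "f \<in> W" by simp
      \<comment> \<open>If \<open>f\<close> were zero, \<open>f - g\<close> in \<open>K\<close>
        would put \<open>g\<close> into \<open>K\<close>.\<close>
      have "f \<noteq> 0" using T.subspace_neg[OF KS f(4)] g by auto
      interpret stable_subspace sc m n l s eps e th1 th2 \<sigma> \<zeta> y f \<gamma> \<chi> W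
      proof unfold_locales
        \<comment> \<open>The product \<open>th1 * \<chi>\<close> is a sign.\<close>
        show "\<chi> \<noteq> 0" using assms(7,9) by auto
      qed (use f fW W stable in auto)
      have "T \<subseteq> W" using reach_eq_T[OF assms(10) \<open>f \<noteq> 0\<close>] reach_W by blast
      then show ?thesis using W by blast
    qed blast
  qed
qed

end
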